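(* Let $d\ge 2$ be an integer. For all $\delta\in(1,d)$ and all $\varepsilon>0$ there exist a real number $\delta'$ with $|\delta-\delta'|\le\varepsilon$, a constant $\kappa>0$, and a family $\mathcal P$ of finite subsets of $\mathbb R^d$ of fractal dimension at most $\delta'$, such that for every $n_0\in\mathbb N$ the family $\mathcal P$ contains a set $P$ with $n=|P|\ge n_0$ points having the following property: for every $c\ge 1$, every $c$-spanner $G$ of $P$ has treewidth $$\mathsf{tw}(G)\ \ge\ \kappa\cdot\frac{n^{1-1/\delta'}}{c^{\,d-1}}.$$
   Context: Nets: for $P\subseteq\mathbb R^d$ and $\rho>0$, a $\rho$-net of $P$ is a set $N\subseteq P$ such that distinct points of $N$ are at Euclidean distance greater than $\rho$ and every point of $P$ is within distance $\rho$ of $N$. $\mathsf{ball}(x,r)$ is the Euclidean ball of center $x$ and radius $r$. Fractal dimension: the fractal dimension $\dim_{\mathsf f}(P)$ of $P\subseteq\mathbb R^d$ is the infimum of the $s$ such that for all $\rho>0$, $r\ge 2\rho$, every $\rho$-net $N$ of $P$ and every $x\in\mathbb R^d$ one has $|N\cap\mathsf{ball}(x,r)|=O((r/\rho)^s)$. For a family $\mathcal P$ of finite sets, the implied constant is required to be uniform over the family: $\dim_{\mathsf f}(\mathcal P)$ is the infimum of the $s$ for which there is a constant $C$ with $|N\cap\mathsf{ball}(x,r)|\le C(r/\rho)^s$ for all $P\in\mathcal P$, $\rho>0$, $r\ge2\rho$, every $\rho$-net $N$ of $P$ and all $x\in\mathbb R^d$. Spanner: for $c\ge1$, a $c$-spanner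 of $P$ is an (edge-weighted) graph $G$ with $V(G)=P$ such that $\|x-y\|_2\le d_G(x,y)\le c\,\|x-y\|_2$ for all $x,y\in P$, where $d_G$ is the shortest-path distance in $G$. Treewidth: a tree-decomposition of $G$ is a tree $T$ with vertex sets $V_t\subseteq V(G)$, $t\in T$, such that $\bigcup_t V_t=V(G)$, each edge of $G$ has both ends in some $V_t$, and $V_{t_1}\cap V_{t_3}\subseteq V_{t_2}$ whenever $t_2$ is on the path from $t_1$ to $t_3$ in $T$. Its width is $\max_t|V_t|$ (no $-1$ is subtracted), and $\mathsf{tw}(G)$ is the least width of a tree-decomposition of $G$. *)

theory Defs
  imports
    "HOL-Analysis.Analysis"
    "Graph_Theory.Digraph_Component"
    "Graph_Theory.Pair_Digraph"
    "Graph_Theory.Shortest_Path"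
begin

definition rho_net :: "real \<Rightarrow> 'a::metric_space set \<Rightarrow> 'a set \<Rightarrow> bool" where
  "rho_net \<rho> P N \<longleftrightarrow>
     N \<subseteq> P \<and>
     (\<forall>x\<in>N. \<forall>y\<in>N. x \<noteq> y \<longrightarrow> dist x y > \<rho>) \<and>
     (\<forall>x\<in>P. \<exists>y\<in>N. dist x y \<le> \<rho>)"

text \<open>
  Fractal dimension of a family, with one constant for the whole family. The infimum is taken
  in the extended reals: it is infinite if no exponent works, and minus infinity if every
  member of the family is empty. The intersections are finite, being bounded and \<open>\<rho>\<close>-separated.
\<close>
definition fractal_dim :: "'a::euclidean_space set set \<Rightarrow> ereal" where
  "fractal_dim \<P> = Inf {ereal s |s. \<exists>C::real.
     \<forall>P\<in>\<P>. \<forall>\<rho>>0. \<forall>r\<ge>2 * \<rho>. \<forall>N x.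
       rho_net \<rho> P N \<longrightarrow> real (card (N \<inter> cball x r)) \<le> C * (r / \<rho>) powr s}"

text \<open>
  A finite simple undirected graph is a symmetric loop-free digraph (\<open>pair_graph\<close>), and an
  edge weighting is a weight function on arcs that does not depend on the orientation.
  The distance \<open>\<mu>\<close> is the infimum of the weights of all walks, and is infinite if there are none.
  Nonnegativity of the weights need not be imposed: the weight of an edge between \<open>x\<close> and \<open>y\<close>
  is at least \<open>\<mu>\<close>, which is at least \<open>dist x y\<close>, which is positive.
\<close>
definition spanner ::
  "real \<Rightarrow> 'a::euclidean_space set \<Rightarrow> 'a pair_pre_digraph \<Rightarrow> ('a \<times> 'a \<Rightarrow> real) \<Rightarrow> bool" where
  "spanner c P G w \<longleftrightarrow>
     pair_graph G \<and> pverts G = P \<and>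
     (\<forall>x y. (x, y) \<in> parcs G \<longrightarrow> w (x, y) = w (y, x)) \<and>
     (\<forall>x\<in>P. \<forall>y\<in>P.
        ereal (dist x y) \<le> wf_digraph.\<mu> (with_proj G) w x y \<and>
        wf_digraph.\<mu> (with_proj G) w x y \<le> ereal (c * dist x y))"

text \<open>
  The constant \<open>tree\<close> of the library does not fit here, since in a symmetric digraph every edge
  gives a directed cycle of length 2. The cycles of the undirected graph are those of length
  at least 3.
\<close>
definition undirected_tree :: "'t pair_pre_digraph \<Rightarrow> bool" where
  "undirected_tree T \<longleftrightarrow>
     pair_graph T \<and> Digraph_Component.connected (with_proj T) \<and>
     \<not> (\<exists>p. pre_digraph.cycle (with_proj T) p \<and> length p \<ge> 3)"

definition tree_decomposition ::
  "'a pair_pre_digraph \<Rightarrow> 't pair_pre_digraph \<Rightarrow> ('t \<Rightarrow> 'a set) \<Rightarrow> bool" where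
  "tree_decomposition G T V \<longleftrightarrow>
     undirected_tree T \<and>
     (\<Union>t\<in>pverts T. V t) = pverts G \<and>
     (\<forall>u v. (u, v) \<in> parcs G \<longrightarrow> (\<exists>t\<in>pverts T. u \<in> V t \<and> v \<in> V t)) \<and>
     (\<forall>t1 t2 t3 p. pre_digraph.apath (with_proj T) t1 p t3 \<and>
        t2 \<in> set (pre_digraph.awalk_verts (with_proj T) t1 p) \<longrightarrow> V t1 \<inter> V t3 \<subseteq> V t2)"

text \<open>No 1 is subtracted in the width.\<close>
definition width :: "'t pair_pre_digraph \<Rightarrow> ('t \<Rightarrow> 'a set) \<Rightarrow> nat" where
  "width T V = Max ((\<lambda>t. card (V t)) ` pverts T)"

text \<open>
  Trees are finite, so up to isomorphism their nodes are natural numbers.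
\<close>
definition treewidth :: "'a pair_pre_digraph \<Rightarrow> nat" where
  "treewidth G = (LEAST k. \<exists>(T :: nat pair_pre_digraph) V.
     tree_decomposition G T V \<and> width T V = k)"

end

theory Submission
  imports Defs
begin

text \<open>
  Let \<open>C\<close> be the set of naturals below \<open>b ^ k\<close> all of whose base \<open>b\<close> digits are smaller than
  \<open>a\<close>, a Cantor set of dimension \<open>\<alpha> = ln a / ln b\<close>. The point set consists of the integer points
  of the cube of side \<open>N = b ^ k\<close> with at most one coordinate outside \<open>C\<close>: a \<open>d\<close>-dimensional grid
  with vertex set \<open>C ^ d\<close> whose edges are subdivided into unit steps. It has about \<open>N ^ \<delta>'\<close>
  points and dimension \<open>\<delta>' = 1 + (d - 1) \<alpha>\<close>, and \<open>a\<close>, \<open>b\<close> are powers of 2 with \<open>\<delta>'\<close> close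
  to \<open>\<delta>\<close>.

  In a \<open>c\<close>-spanner, every axis-parallel line of the grid is contained in a connected vertex set that
  stays within distance \<open>2 * c\<close> of the line. A vertex is thus close to at most \<open>(5 * c) ^ (d - 1)\<close>
  lines of each direction, and deleting much fewer than \<open>card C ^ (d - 1) / c ^ (d - 1)\<close> vertices
  spoils only a small fraction of the lines. For most pairs of grid vertices, the path that changes
  one coordinate at a time uses no spoiled line, so some component still contains more than half of
  \<open>C ^ d\<close>. Two connected sets containing more than half of \<open>C ^ d\<close> meet, and by the duality of
  brambles and tree-decompositions some bag meets all such sets; hence that bag is large.
\<close>

section \<open>Brambles and tree-decompositions\<close>

text \<open>Reachability after deletion of \<open>S\<close>. Being reflexive on the whole type, the
  relation contains \<open>(x, x)\<close> even for \<open>x\<close> in \<open>S\<close>, so start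
  points have to be kept out of \<open>S\<close> separately.\<close>

abbreviation avoiding :: "'t pair_pre_digraph \<Rightarrow> 't set \<Rightarrow> ('t \<times> 't) set" where
  "avoiding T S \<equiv> (Restr (parcs T) (- S))\<^sup>*"

text \<open>Deleting the complement of \<open>X\<close> keeps the connecting walks inside
  \<open>X\<close>. The empty set counts as connected.\<close>

definition connected_in :: "'a pair_pre_digraph \<Rightarrow> 'a set \<Rightarrow> bool" where
  "connected_in G X \<longleftrightarrow> (\<forall>x\<in>X. \<forall>y\<in>X. (x, y) \<in> avoiding G (- X))"

lemma avoiding_sym:
  assumes "pair_graph T" "(x, y) \<in> avoiding T S"
  shows "(y, x) \<in> avoiding T S"
proof -
  interpret pair_graph T by fact
  have "sym (Restr (parcs T) (- S))"
    by (auto simp: sym_def dest: arcs_symmetric)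
  then show ?thesis
    using assms(2) by (meson sym_rtrancl symD)
qed

text \<open>Passes from the closure to paths, in terms of which tree-decompositions are defined and
  from which cycles are built.\<close>

lemma (in pair_wf_digraph) avoiding_obtains_apath:
  assumes "(u, v) \<in> avoiding G S" "u \<in> pverts G" "u \<notin> S"
  obtains p where "apath u p v" "set (awalk_verts u p) \<inter> S = {}"
proof -
  from assms(1) have "\<exists>p. awalk u p v \<and> set (awalk_verts u p) \<inter> S = {}"
  proof (induction rule: converse_rtrancl_induct)
    case base
    show ?case
    proof (cases "v = u")
      case True
      then show ?thesis
        using assms by (intro exI[of _ "[]"]) (auto simp: awalk_Nil_iff)
    next
      case False
      then have "(v \<in> pverts G) \<and> v \<notin> S"
        using rtranclE[OF assms(1)] in_arcsD2 by blast
      then show ?thesis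
        by (intro exI[of _ "[]"]) (auto simp: awalk_Nil_iff)
    qed
  next
    case (step y z)
    then obtain p where "awalk z p v" "set (awalk_verts z p) \<inter> S = {}" by auto
    then show ?case
      using step by (intro exI[of _ "(y, z) # p"]) (auto simp: awalk_Cons_iff)
  qed
  then obtain p where p: "awalk u p v" "set (awalk_verts u p) \<inter> S = {}" by auto
  let ?q = "awalk_to_apath p"
  have q: "apath u ?q v" by (rule apath_awalk_to_apath[OF p(1)])
  have "set (awalk_verts u ?q) \<subseteq> set (awalk_verts u p)"
    using set_awalk_verts[OF p(1)] set_awalk_verts[OF awalkI_apath[OF q]]
      awalk_to_apath_subset[OF p(1)] by auto
  with that q p show ?thesis by blast
qed

lemma (in pair_wf_digraph) awalk_avoiding:
  assumes "awalk u p v" "set (awalk_verts u p) \<inter> S = {}" "x \<in> set (awalk_verts u p)"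
  shows "(u, x) \<in> avoiding G S"
  using assms
proof (induction p arbitrary: u)
  case Nil
  then show ?case by (auto simp: awalk_Nil_iff)
next
  case (Cons e p)
  have e: "e \<in> parcs G" "u = fst e" "awalk (snd e) p v"
    using Cons.prems by (auto simp: awalk_Cons_iff)
  have "(u, x) \<in> avoiding G S" if "x \<noteq> u"
  proof -
    have "snd e \<in> set (awalk_verts (snd e) p)"
      using e(3) hd_in_awalk_verts by blast
    then have "(u, snd e) \<in> Restr (parcs G) (- S)"
      using e Cons.prems(2) by (cases e) auto
    moreover have "(snd e, x) \<in> avoiding G S"
      using Cons e that by auto
    ultimately show ?thesis by (rule converse_rtrancl_into_rtrancl)
  qed
  then show ?case by auto
qed

text \<open>A path from \<open>c\<close> to \<open>a\<close> that avoids \<open>b\<close> closes up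
  through \<open>b\<close> to a cycle.\<close>

lemma undirected_tree_branches_disjoint:
  assumes "undirected_tree T" "(b, a) \<in> parcs T" "(b, c) \<in> parcs T" "a \<noteq> c"
  shows "(c, a) \<notin> avoiding T {b}"
proof
  assume *: "(c, a) \<in> avoiding T {b}"
  interpret pair_graph T using assms(1) by (simp add: undirected_tree_def)
  have "c \<in> pverts T" "c \<noteq> b" "a \<noteq> b"
    using assms(2,3) in_arcsD2 no_loops' by blast+
  then obtain p where p: "apath c p a" "set (awalk_verts c p) \<inter> {b} = {}"
    using avoiding_obtains_apath[OF *] by auto
  have ab: "(a, b) \<in> parcs T" using assms(2) arcs_symmetric by auto
  let ?q = "(b, c) # p @ [(a, b)]"
  have w: "awalk c p a" using p by (simp add: apath_def)
  have *: "awalk c (p @ [(a, b)]) b"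
    using w ab by (intro awalk_appendI[OF w]) (auto simp: awalk_simps dest: in_arcsD2)
  then have "awalk b ?q b"
    using assms(3) by (auto simp: awalk_Cons_iff)
  moreover have "awalk_verts c (p @ [(a, b)]) = awalk_verts c p @ [b]"
    using awalk_verts_append[OF *] w by (auto)
  then have "distinct (tl (awalk_verts b ?q))"
    using p by (auto simp: apath_def)
  ultimately have "cycle ?q" unfolding cycle_def by blast
  \<comment> \<open>Since \<open>a \<noteq> c\<close>, the cycle is not one edge traversed back and
    forth, which trees permit.\<close>
  moreover have "p \<noteq> []" using w assms(4) by (auto simp: awalk_Nil_iff)
  then have "length ?q \<ge> 3" by (cases p) auto
  ultimately show False using assms(1) unfolding undirected_tree_def by blast
qed

text \<open>Cut the walk after its last visit to \<open>b\<close>: \<open>c\<close> is the next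
  vertex, and what follows avoids \<open>b\<close>.\<close>

lemma avoiding_change_centre:
  assumes "(b, t) \<in> avoiding T S" "t \<noteq> b"
  obtains c where "c \<notin> S" "(b, c) \<in> parcs T" "(c, t) \<in> avoiding T {b}"
proof -
  from assms have "\<exists>c. c \<notin> S \<and> (b, c) \<in> parcs T \<and> (c, t) \<in> avoiding T {b}"
  proof (induction rule: rtrancl_induct)
    case (step y z)
    show ?case
    proof (cases "y = b")
      case True
      then show ?thesis using step.hyps(2) by blast
    next
      case False
      then obtain c where c: "c \<notin> S" "(b, c) \<in> parcs T" "(c, y) \<in> avoiding T {b}"
        using step.IH by blast
      have "(y, z) \<in> Restr (parcs T) (- {b})" using step False by blast
      with c(3) have "(c, z) \<in> avoiding T {b}" by (rule rtrancl_into_rtrancl)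
      with c show ?thesis by blast
    qed
  qed simp
  with that show ?thesis by auto
qed

lemma undirected_tree_reach:
  assumes "undirected_tree T" "u \<in> pverts T" "v \<in> pverts T"
  shows "(u, v) \<in> (parcs T)\<^sup>*"
proof -
  interpret pair_graph T using assms(1) by (simp add: undirected_tree_def)
  have "strongly_connected (with_proj T)"
    using assms(1) symmetric_connected_imp_strongly_connected[OF sym_arcs]
    unfolding undirected_tree_def by auto
  then have "u \<rightarrow>\<^sup>*\<^bsub>with_proj T\<^esub> v"
    using assms(2,3) by (auto simp: strongly_connected_def)
  then obtain p where "awalk u p v" using reachable_awalk by blast
  moreover have "v \<in> set (awalk_verts u p)" using \<open>awalk u p v\<close> by auto
  ultimately show ?thesis using awalk_avoiding[of u p v "{}" v] by simp
qed

definition bag_nodes :: "'t pair_pre_digraph \<Rightarrow> ('t \<Rightarrow> 'a set) \<Rightarrow> 'a set \<Rightarrow> 't set" where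
  "bag_nodes T V X = {t \<in> pverts T. V t \<inter> X \<noteq> {}}"

text \<open>The nodes whose bags contain a fixed \<open>x\<close> in \<open>X\<close> are joined by
  tree paths through bags containing \<open>x\<close>, and \<open>b\<close> is not on these. Each
  edge inside \<open>X\<close> lies in a bag, so walking through \<open>X\<close> shows that all
  bags meeting \<open>X\<close> are on the same side of \<open>b\<close>.\<close>

lemma tree_decomposition_connected_in_branch:
  assumes td: "tree_decomposition G T V"
    and X: "X \<subseteq> pverts G" "X \<noteq> {}" "connected_in G X"
    and b: "b \<in> pverts T" "V b \<inter> X = {}"
  obtains c where "(b, c) \<in> parcs T" "\<And>t. t \<in> bag_nodes T V X \<Longrightarrow> (c, t) \<in> avoiding T {b}"
proof -
  have tree: "undirected_tree T" using td by (simp add: tree_decomposition_def)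
  then interpret pair_graph T by (simp add: undirected_tree_def)
  have same_vertex: "(s, t) \<in> avoiding T {b}"
    if x: "x \<in> X" "s \<in> pverts T" "t \<in> pverts T" "x \<in> V s" "x \<in> V t" for x s t
  proof -
    have "(s, t) \<in> avoiding T {}"
      using undirected_tree_reach[OF tree x(2,3)] by simp
    then obtain p where p: "apath s p t"
      using avoiding_obtains_apath x(2) by blast
    have "x \<in> V t'" if "t' \<in> set (awalk_verts s p)" for t'
      using td p that x(4,5) unfolding tree_decomposition_def awalk_verts_with_proj_eq
      by blast
    then have "b \<notin> set (awalk_verts s p)" using b x(1) by auto
    moreover have "awalk s p t" using p by (simp add: apath_def)
    moreover have "t \<in> set (awalk_verts s p)" using \<open>awalk s p t\<close> by auto
    ultimately show ?thesis using awalk_avoiding by auto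
  qed
  have same_component: "\<And>s t. s \<in> pverts T \<Longrightarrow> x \<in> V s \<Longrightarrow> t \<in> pverts T \<Longrightarrow> y \<in> V t \<Longrightarrow> (s, t) \<in> avoiding T {b}"
    if "x \<in> X" "(x, y) \<in> avoiding G (- X)" for x y
    using that(2)
  proof (induction rule: rtrancl_induct)
    case base
    then show ?case using same_vertex that by auto
  next
    case (step y z)
    then obtain t' where t': "t' \<in> pverts T" "y \<in> V t'" "z \<in> V t'"
      using td unfolding tree_decomposition_def by blast
    have "(s, t') \<in> avoiding T {b}" using step.IH step.prems t' by auto
    moreover have "(t', t) \<in> avoiding T {b}"
      using same_vertex[of z] t' step by auto
    ultimately show ?case by (rule rtrancl_trans)
  qed
  obtain x t0 where x: "x \<in> X" and t0: "t0 \<in> pverts T" "x \<in> V t0"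
    using X td unfolding tree_decomposition_def by blast
  then have "t0 \<noteq> b" using b by auto
  moreover have "(b, t0) \<in> avoiding T {}"
    using undirected_tree_reach[OF tree b(1) t0(1)] by simp
  ultimately obtain c where c: "(b, c) \<in> parcs T" "(c, t0) \<in> avoiding T {b}"
    using avoiding_change_centre by metis
  have "(c, t) \<in> avoiding T {b}" if t: "t \<in> bag_nodes T V X" for t
  proof -
    obtain y where "y \<in> X" "y \<in> V t" "t \<in> pverts T" using t by (auto simp: bag_nodes_def)
    then have "(t0, t) \<in> avoiding T {b}"
      using same_component[OF x, of y] X(3) x t0 unfolding connected_in_def by blast
    with c(2) show ?thesis by (rule rtrancl_trans)
  qed
  with c(1) that show thesis by blast
qed

text \<open>
  If every bag misses some \<open>X\<close>, then every node \<open>b\<close> points to the branch at \<open>b\<close> that contains all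
  bags meeting such an \<open>X\<close>. An edge from \<open>a\<close> to \<open>b\<close> whose branch is smallest cannot be continued
  away from \<open>a\<close>, so \<open>a\<close> and \<open>b\<close> point to each other, which gives two disjoint sets.
\<close>
lemma tree_decomposition_bag_hits_all:
  assumes td: "tree_decomposition G T V"
    and ne_T: "pverts T \<noteq> {}"
    and sub: "\<And>X. X \<in> \<B> \<Longrightarrow> X \<subseteq> pverts G"
    and conn: "\<And>X. X \<in> \<B> \<Longrightarrow> connected_in G X"
    and meet: "\<And>X Y. X \<in> \<B> \<Longrightarrow> Y \<in> \<B> \<Longrightarrow> X \<inter> Y \<noteq> {}"
  obtains t where "t \<in> pverts T" "\<And>X. X \<in> \<B> \<Longrightarrow> V t \<inter> X \<noteq> {}"
proof (rule ccontr)
  assume "\<not> thesis"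
  with that have avoid: "\<exists>X\<in>\<B>. V t \<inter> X = {}" if "t \<in> pverts T" for t
    using that by blast
  have tree: "undirected_tree T" using td by (simp add: tree_decomposition_def)
  then interpret pair_graph T by (simp add: undirected_tree_def)
  have pg: "pair_graph T" ..
  have ne: "X \<noteq> {}" if "X \<in> \<B>" for X using meet[OF that that] by auto
  \<comment> \<open>For an arc from \<open>b\<close> to \<open>c\<close>, \<open>D b c\<close> is
    the branch at \<open>b\<close> that contains \<open>c\<close>. \<open>Q\<close> marks the arcs
    whose branch holds all bags meeting some member of \<open>\<B>\<close>.\<close>
  define D where "D b c = {t. (c, t) \<in> avoiding T {b}}" for b c
  define Q where "Q = (\<lambda>(a, b). (a, b) \<in> parcs T \<and> (\<exists>X\<in>\<B>. bag_nodes T V X \<subseteq> D a b))"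
  have branch: "\<exists>c X. (b, c) \<in> parcs T \<and> X \<in> \<B> \<and> V b \<inter> X = {} \<and> bag_nodes T V X \<subseteq> D b c"
    if b: "b \<in> pverts T" for b
  proof -
    obtain X where X: "X \<in> \<B>" "V b \<inter> X = {}" using avoid[OF b] by auto
    obtain c where "(b, c) \<in> parcs T" "\<And>t. t \<in> bag_nodes T V X \<Longrightarrow> (c, t) \<in> avoiding T {b}"
      by (rule tree_decomposition_connected_in_branch[OF td sub[OF X(1)] ne[OF X(1)] conn[OF X(1)] b X(2)]) blast+
    with X show ?thesis unfolding D_def by blast
  qed
  have D_finite: "finite (D a b)" if "(a, b) \<in> parcs T" for a b
  proof (rule finite_subset[OF _ pair_finite_verts])
    show "D a b \<subseteq> pverts T"
    proof
      fix t assume "t \<in> D a b"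
      then have "(b, t) \<in> avoiding T {a}" by (simp add: D_def)
      then show "t \<in> pverts T"
        by (cases rule: rtranclE) (use that in \<open>auto dest: in_arcsD2\<close>)
    qed
  qed
  obtain e where e: "Q e"
  proof -
    obtain b where "b \<in> pverts T" using ne_T by auto
    then show ?thesis using branch[of b] that unfolding Q_def by blast
  qed
  obtain a b where Q: "Q (a, b)" and min: "\<And>e. Q e \<Longrightarrow> card (D a b) \<le> card (D (fst e) (snd e))"
  proof -
    obtain e' where "Q e'" "\<And>e. Q e \<Longrightarrow> card (D (fst e') (snd e')) \<le> card (D (fst e) (snd e))"
      using exists_least_iff[of "\<lambda>n. \<exists>e. Q e \<and> card (D (fst e) (snd e)) = n"] e
      by (metis linorder_not_le)
    then show ?thesis using that[of "fst e'" "snd e'"] by simp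
  qed
  have ab: "(a, b) \<in> parcs T" "(b, a) \<in> parcs T" and "b \<in> pverts T" "a \<noteq> b"
    using Q arcs_symmetric in_arcsD2 no_loops' unfolding Q_def by auto
  obtain X where X: "X \<in> \<B>" "bag_nodes T V X \<subseteq> D a b" using Q unfolding Q_def by auto
  obtain c Y where c: "(b, c) \<in> parcs T" and Y: "Y \<in> \<B>" "V b \<inter> Y = {}" "bag_nodes T V Y \<subseteq> D b c"
    using branch[OF \<open>b \<in> pverts T\<close>] by auto
  have "b \<noteq> c" using c no_loops' by auto
  show False
  proof (cases "c = a")
    case True
    \<comment> \<open>A node \<open>t\<close> whose bag has a common vertex of \<open>X\<close> and
      \<open>Y\<close> lies beyond \<open>b\<close> as seen from \<open>a\<close> and beyond
      \<open>a\<close> as seen from \<open>b\<close>. Going from \<open>b\<close> to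
      \<open>t\<close> without passing \<open>a\<close> enters another branch at \<open>b\<close>,
      which then meets the branch of \<open>a\<close>.\<close>
    obtain v where v: "v \<in> X" "v \<in> Y" using meet[OF X(1) Y(1)] by auto
    then obtain t where t: "t \<in> pverts T" "v \<in> V t"
      using td sub[OF X(1)] unfolding tree_decomposition_def by blast
    then have "(b, t) \<in> avoiding T {a}" and at: "(a, t) \<in> avoiding T {b}" and "t \<noteq> b"
      using v X Y True unfolding bag_nodes_def D_def by auto
    then obtain c' where "c' \<notin> {a}" "(b, c') \<in> parcs T" "(c', t) \<in> avoiding T {b}"
      using avoiding_change_centre by metis
    moreover have "(c', a) \<in> avoiding T {b}"
      using \<open>(c', t) \<in> avoiding T {b}\<close> avoiding_sym[OF pg at] by (rule rtrancl_trans)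
    ultimately show False
      using undirected_tree_branches_disjoint[OF tree ab(2)] by blast
  next
    case False
    \<comment> \<open>The branch \<open>D b c\<close> is a proper part of \<open>D a b\<close>: it
      misses \<open>a\<close>, so its walks avoid \<open>a\<close>, and it misses \<open>b\<close>.
      This contradicts minimality.\<close>
    have "Q (b, c)" using c Y unfolding Q_def by auto
    have no_a: "a \<notin> D b c"
      using undirected_tree_branches_disjoint[OF tree ab(2) c] False unfolding D_def by auto
    have "D b c \<subseteq> D a b"
    proof
      fix t assume "t \<in> D b c"
      then have "(c, t) \<in> avoiding T {b}" by (simp add: D_def)
      then show "t \<in> D a b"
      proof (induction rule: rtrancl_induct)
        case base
        then show ?case using c \<open>a \<noteq> b\<close> False by (auto simp: D_def)
      next
        case (step y z)
        then have "y \<in> D b c" "z \<in> D b c"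
          unfolding D_def by (auto intro: rtrancl_into_rtrancl)
        then have "(y, z) \<in> Restr (parcs T) (- {a})" using no_a step by auto
        then show ?case using step.IH unfolding D_def by (auto intro: rtrancl_into_rtrancl)
      qed
    qed
    moreover have "b \<in> D a b" by (simp add: D_def)
    moreover have "b \<notin> D b c"
    proof
      assume "b \<in> D b c"
      then have "(c, b) \<in> avoiding T {b}" by (simp add: D_def)
      then show False
        by (cases rule: rtranclE) (use \<open>b \<noteq> c\<close> in auto)
    qed
    ultimately have "D b c \<subset> D a b" by auto
    then have "card (D b c) < card (D a b)"
      using D_finite[OF ab(1)] psubset_card_mono by blast
    with min[OF \<open>Q (b, c)\<close>] show False by simp
  qed
qed

text \<open>\<open>treewidth\<close> is a \<open>LEAST\<close>, so some decomposition has to be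
  exhibited: a single node whose bag is the whole vertex set.\<close>

lemma treewidth_attained:
  assumes "pair_graph G"
  obtains T :: "nat pair_pre_digraph" and V
  where "tree_decomposition G T V" "width T V = treewidth G"
proof -
  define T :: "nat pair_pre_digraph" where "T = \<lparr> pverts = {0}, parcs = {} \<rparr>"
  interpret T: pair_graph T
    by unfold_locales (auto simp: T_def symmetric_def sym_def arcs_ends_def)
  interpret G: pair_graph G by fact
  have "undirected_tree T"
    unfolding undirected_tree_def
  proof (intro conjI notI)
    show "pair_graph T" ..
    show "Digraph_Component.connected (with_proj T)"
      unfolding connected_def strongly_connected_def
      by (auto simp: mk_symmetric_def T_def reachable_def with_proj_def)
    assume "\<exists>p. pre_digraph.cycle (with_proj T) p \<and> 3 \<le> length p"
    then show False
      unfolding T.cycle_def T.awalk_def by (auto simp: T_def)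
  qed
  then have "tree_decomposition G T (\<lambda>_. pverts G)"
    unfolding tree_decomposition_def by (auto simp: T_def dest: G.in_arcsD1 G.in_arcsD2)
  then have "\<exists>k. \<exists>(T :: nat pair_pre_digraph) V. tree_decomposition G T V \<and> width T V = k"
    by blast
  from LeastI_ex[OF this] show ?thesis
    using that unfolding treewidth_def by blast
qed

section \<open>Connected sets in spanners\<close>

lemma avoiding_mono: "S \<subseteq> S' \<Longrightarrow> avoiding G S' \<subseteq> avoiding G S"
  by (rule rtrancl_mono) auto

lemma connected_in_Un:
  assumes "connected_in G A" "connected_in G B" "A \<inter> B \<noteq> {}"
  shows "connected_in G (A \<union> B)"
proof -
  obtain v where v: "v \<in> A" "v \<in> B" using assms(3) by auto
  have "avoiding G (- A) \<subseteq> avoiding G (- (A \<union> B))" "avoiding G (- B) \<subseteq> avoiding G (- (A \<union> B))"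
    by (rule avoiding_mono; auto)+
  then have "(x, v) \<in> avoiding G (- (A \<union> B)) \<and> (v, x) \<in> avoiding G (- (A \<union> B))" if "x \<in> A \<union> B" for x
    using that v assms(1,2) unfolding connected_in_def by blast
  then show ?thesis
    unfolding connected_in_def using rtrancl_trans by meson
qed

lemma connected_in_component:
  assumes "pair_graph G"
  shows "connected_in G {y. (p, y) \<in> avoiding G H}" (is "connected_in G ?X")
proof -
  have from_p: "(p, y) \<in> avoiding G (- ?X)" if "(p, y) \<in> avoiding G H" for y
    using that
  proof (induction rule: rtrancl_induct)
    case (step y z)
    then have "(p, z) \<in> avoiding G H" by (meson rtrancl_into_rtrancl)
    then have "(y, z) \<in> Restr (parcs G) (- (- ?X))" using step by auto
    with step.IH show ?case by (rule rtrancl_into_rtrancl)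
  qed auto
  then show ?thesis
    using avoiding_sym[OF assms, of p _ "- ?X"]
    unfolding connected_in_def by (blast intro: rtrancl_trans)
qed

context
  fixes c :: real and P :: "'a::euclidean_space set" and G w
  assumes sp: "spanner c P G w"
begin

interpretation pair_graph G
  using sp by (simp add: spanner_def)

text \<open>The arc is itself a walk, so its weight is at least \<open>\<mu>\<close>, which
  dominates the Euclidean distance.\<close>

lemma spanner_arc_weight:
  assumes "(x, y) \<in> parcs G"
  shows "dist x y \<le> w (x, y)"
proof -
  have "x \<in> P" "y \<in> P" using assms sp in_arcsD1 in_arcsD2 by (auto simp: spanner_def)
  then have "ereal (dist x y) \<le> \<mu> w x y" using sp by (simp add: spanner_def)
  also have "\<dots> \<le> awalk_cost w [(x, y)]"
    using arc_implies_awalk[OF assms] by (intro min_cost_le_walk_cost) simp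
  finally show ?thesis by simp
qed

text \<open>Triangle inequality along the walk up to \<open>z\<close>; the rest of the walk has
  nonnegative cost.\<close>

lemma spanner_dist_le_walk_cost:
  assumes "awalk u p v" "z \<in> set (awalk_verts u p)"
  shows "dist u z \<le> awalk_cost w p"
  using assms
proof (induction p arbitrary: u z)
  case Nil
  then show ?case by auto
next
  case (Cons e p)
  have e: "(u, snd e) \<in> parcs G" "u = fst e" "awalk (snd e) p v"
    using Cons.prems by (auto simp: awalk_Cons_iff)
  have cost: "dist (snd e) x \<le> awalk_cost w p" if "x \<in> set (awalk_verts (snd e) p)" for x
    using Cons.IH[OF e(3)] that by auto
  have "snd e \<in> set (awalk_verts (snd e) p)"
    using e(3) hd_in_awalk_verts by blast
  from cost[OF this] have "awalk_cost w p \<ge> 0" by simp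
  have we: "dist u (snd e) \<le> w e" using spanner_arc_weight[OF e(1)] e(2) by simp
  show ?case
  proof (cases "z = u")
    case True
    then show ?thesis
      using \<open>awalk_cost w p \<ge> 0\<close> order_trans[OF zero_le_dist we] by simp
  next
    case False
    then have "z \<in> set (awalk_verts (snd e) p)" using Cons.prems e by auto
    then show ?thesis using cost we dist_triangle[of u z "snd e"] by fastforce
  qed
qed

text \<open>\<open>\<mu>\<close> is an infimum over walks. As \<open>c * dist u v\<close> is
  positive, doubling it leaves room for an actual walk, and \<open>Z\<close> is its vertex
  set.\<close>

lemma spanner_connector:
  assumes "u \<in> P" "v \<in> P" "u \<noteq> v" "c > 0"
  obtains Z where "u \<in> Z" "v \<in> Z" "Z \<subseteq> P" "connected_in G Z"
    "\<And>z. z \<in> Z \<Longrightarrow> dist u z \<le> 2 * c * dist u v"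
proof -
  have "\<mu> w u v \<le> ereal (c * dist u v)" using assms sp by (simp add: spanner_def)
  also have "\<dots> < ereal (2 * c * dist u v)" using assms by simp
  finally obtain p where p: "awalk u p v" "awalk_cost w p < 2 * c * dist u v"
    unfolding \<mu>_def by (auto simp: INF_less_iff)
  let ?Z = "set (awalk_verts u p)"
  have from_u: "(u, z) \<in> avoiding G (- ?Z)" if "z \<in> ?Z" for z
    using awalk_avoiding[OF p(1) _ that, of "- ?Z"] by auto
  have "pair_graph G" ..
  then have "connected_in G ?Z"
    using from_u avoiding_sym[of G u _ "- ?Z"]
    unfolding connected_in_def by (blast intro: rtrancl_trans)
  moreover have "?Z \<subseteq> P" using p(1) sp by (auto simp: spanner_def)
  moreover have "u \<in> ?Z" "v \<in> ?Z" using p(1) hd_in_awalk_verts by auto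
  moreover have "dist u z \<le> 2 * c * dist u v" if "z \<in> ?Z" for z
    using spanner_dist_le_walk_cost[OF p(1) that] p(2) by simp
  ultimately show ?thesis using that by blast
qed

text \<open>Connectors of consecutive points share an end, so their union is connected. Each has
  radius \<open>2 * c\<close> because the steps have length 1.\<close>

lemma spanner_thick_path:
  assumes "\<And>i. i \<le> n \<Longrightarrow> f i \<in> P" "\<And>i. i < n \<Longrightarrow> dist (f i) (f (Suc i)) = 1" "c > 0"
  shows "\<exists>Z. f ` {..n} \<subseteq> Z \<and> Z \<subseteq> P \<and> connected_in G Z \<and> (\<forall>z\<in>Z. \<exists>i\<le>n. dist (f i) z \<le> 2 * c)"
  using assms(1,2)
proof (induction n)
  case 0
  then show ?case using \<open>c > 0\<close>
    by (intro exI[of _ "{f 0}"]) (auto simp: connected_in_def)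
next
  case (Suc n)
  then obtain Z where Z: "f ` {..n} \<subseteq> Z" "Z \<subseteq> P" "connected_in G Z"
      "\<And>z. z \<in> Z \<Longrightarrow> \<exists>i\<le>n. dist (f i) z \<le> 2 * c"
    by (metis le_SucI less_SucI)
  have d: "dist (f n) (f (Suc n)) = 1" using Suc by auto
  then have "f n \<noteq> f (Suc n)" by auto
  then obtain Y where Y: "f n \<in> Y" "f (Suc n) \<in> Y" "Y \<subseteq> P" "connected_in G Y"
      "\<And>z. z \<in> Y \<Longrightarrow> dist (f n) z \<le> 2 * c"
    using spanner_connector[of "f n" "f (Suc n)"] Suc.prems(1) \<open>c > 0\<close> d
    by (metis le_SucI mult.right_neutral order_refl)
  have "f n \<in> Z \<inter> Y" using Z(1) Y(1) by auto
  then have "connected_in G (Z \<union> Y)" using connected_in_Un Z(3) Y(4) by blast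
  moreover have "\<exists>i\<le>Suc n. dist (f i) z \<le> 2 * c" if "z \<in> Z \<union> Y" for z
    using that Z(4) Y(5) le_SucI by blast
  moreover have "f ` {..Suc n} \<subseteq> Z \<union> Y" using Z(1) Y(2) by (auto simp: atMost_Suc)
  ultimately show ?case using Z(2) Y(3) by (intro exI[of _ "Z \<union> Y"]) auto
qed

end

section \<open>The crossbar\<close>

definition point :: "('n \<Rightarrow> nat) \<Rightarrow> real ^ 'n" where
  "point f = (\<chi> l. real (f l))"

definition crossbar :: "nat set \<Rightarrow> nat \<Rightarrow> (real ^ 'n) set" where
  "crossbar C N = point ` {f. (\<forall>l. f l < N) \<and> (\<exists>l0. \<forall>l. l \<noteq> l0 \<longrightarrow> f l \<in> C)}"

text \<open>Over \<open>UNIV\<close> the extensionality condition is void; the form gives access to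
  the cardinality rules for product sets.\<close>

abbreviation grid :: "nat set \<Rightarrow> ('n \<Rightarrow> nat) set" where
  "grid C \<equiv> UNIV \<rightarrow>\<^sub>E C"

text \<open>As \<open>A\<close> grows by one coordinate at a time, these are the corners of a path
  from \<open>p\<close> to \<open>q\<close> along grid lines.\<close>

definition interpolate :: "'n set \<Rightarrow> ('n \<Rightarrow> nat) \<Rightarrow> ('n \<Rightarrow> nat) \<Rightarrow> 'n \<Rightarrow> nat" where
  "interpolate A p q = (\<lambda>l. if l \<in> A then q l else p l)"

lemma inj_point: "inj point"
  by (auto simp: inj_def point_def vec_eq_iff)

section \<open>Counting grid vertices and pairs of them\<close>

lemma finite_nat_near: "finite {t::nat. \<bar>real t - x\<bar> \<le> r}"
proof (rule finite_subset)
  show "{t::nat. \<bar>real t - x\<bar> \<le> r} \<subseteq> {..nat \<lceil>x + r\<rceil>}"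
    by (auto simp: abs_le_iff) linarith
qed simp

lemma card_nat_near:
  assumes "r \<ge> 0"
  shows "real (card {t::nat. \<bar>real t - x\<bar> \<le> r}) \<le> 2 * r + 1"
proof -
  let ?I = "{\<lceil>x - r\<rceil>..\<lfloor>x + r\<rfloor>}"
  have "card {t::nat. \<bar>real t - x\<bar> \<le> r} \<le> card ?I"
  proof (rule card_inj_on_le[where f = int])
    show "int ` {t. \<bar>real t - x\<bar> \<le> r} \<subseteq> ?I"
      by (auto simp: abs_le_iff ceiling_le_iff le_floor_iff)
  qed auto
  also have "real (card ?I) \<le> 2 * r + 1"
    using assms by (simp add: of_nat_nat) linarith
  finally show ?thesis by simp
qed

lemma card_grid: "finite C \<Longrightarrow> card (grid C :: ('n::finite \<Rightarrow> nat) set) = card C ^ CARD('n)"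
  by (simp add: card_PiE)

lemma finite_grid: "finite C \<Longrightarrow> finite (grid C :: ('n::finite \<Rightarrow> nat) set)"
  by (simp add: finite_PiE)

text \<open>Coordinate \<open>l\<close> is free in \<open>C\<close>, and every other one lies in an
  interval of length \<open>2 * r\<close>. This bounds the number of grid vertices whose line in
  direction \<open>l\<close> passes near \<open>z\<close>.\<close>

lemma card_grid_near_line:
  fixes z :: "real ^ 'n::finite" and r :: real
  assumes "finite C" "r \<ge> 0"
  shows "finite {f \<in> grid C. \<forall>l'. l' \<noteq> l \<longrightarrow> \<bar>real (f l') - z $ l'\<bar> \<le> r}"
    and "real (card {f \<in> grid C. \<forall>l'. l' \<noteq> l \<longrightarrow> \<bar>real (f l') - z $ l'\<bar> \<le> r})
      \<le> card C * (2 * r + 1) ^ (CARD('n) - 1)"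
proof -
  let ?S = "{f \<in> grid C. \<forall>l'. l' \<noteq> l \<longrightarrow> \<bar>real (f l') - z $ l'\<bar> \<le> r}"
  let ?F = "\<lambda>l'. if l' = l then C else {t::nat. \<bar>real t - z $ l'\<bar> \<le> r}"
  show "finite ?S"
    by (rule finite_subset[OF _ finite_grid[OF assms(1)]]) auto
  have "card ?S \<le> card (PiE UNIV ?F)"
    using assms finite_nat_near by (intro card_mono finite_PiE) (auto simp: PiE_iff)
  also have "\<dots> = (\<Prod>l'\<in>UNIV. card (?F l'))" by (simp add: card_PiE)
  also have "\<dots> = card C * (\<Prod>l'\<in>UNIV - {l}. card (?F l'))"
    by (simp add: prod.remove[of UNIV l])
  finally have "real (card ?S) \<le> real (card C * (\<Prod>l'\<in>UNIV - {l}. card (?F l')))"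
    by (rule of_nat_mono)
  also have "\<dots> = card C * (\<Prod>l'\<in>UNIV - {l}. real (card (?F l')))"
    unfolding of_nat_mult of_nat_prod ..
  also have "\<dots> \<le> card C * (\<Prod>l'\<in>UNIV - {l}. 2 * r + 1)"
    using card_nat_near[OF assms(2)] by (intro mult_left_mono prod_mono) auto
  finally show "real (card ?S) \<le> card C * (2 * r + 1) ^ (CARD('n) - 1)"
    by simp
qed

text \<open>Exchanging the coordinates in \<open>A\<close> between \<open>p\<close> and \<open>q\<close> is an involution on pairs.\<close>
lemma card_interpolate_in:
  fixes B :: "('n::finite \<Rightarrow> nat) set"
  assumes "finite C" "B \<subseteq> grid C"
  shows "card {(p, q). p \<in> grid C \<and> q \<in> grid C \<and> interpolate A p q \<in> B} \<le> card B * card (grid C :: ('n \<Rightarrow> nat) set)"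
proof -
  let ?S = "{(p, q). p \<in> grid C \<and> q \<in> grid C \<and> interpolate A p q \<in> B}"
  let ?\<phi> = "\<lambda>(p, q). (interpolate A p q, interpolate A q p)"
  have "card ?S \<le> card (B \<times> (grid C :: ('n \<Rightarrow> nat) set))"
  proof (rule card_inj_on_le[where f = ?\<phi>])
    have "?\<phi> (?\<phi> x) = x" for x
      by (cases x) (auto simp: interpolate_def fun_eq_iff)
    then show "inj_on ?\<phi> ?S" by (rule inj_on_inverseI)
    show "?\<phi> ` ?S \<subseteq> B \<times> grid C"
      by (auto simp: interpolate_def PiE_iff)
    show "finite (B \<times> (grid C :: ('n \<Rightarrow> nat) set))"
      using finite_grid[OF assms(1)] assms(2) finite_subset by blast
  qed
  then show ?thesis by (simp add: card_cartesian_product)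
qed

text \<open>Averaging: if every section held at least half of \<open>A\<close>, the pairs would make
  up at least half of \<open>A \<times> A\<close>.\<close>

lemma exists_small_section:
  assumes "finite A" "A \<noteq> {}" "2 * card {(p, q). p \<in> A \<and> q \<in> A \<and> R p q} < card A * card A"
  obtains p where "p \<in> A" "2 * card {q \<in> A. R p q} < card A"
proof (rule ccontr)
  assume "\<not> thesis"
  with that have "card A \<le> 2 * card {q \<in> A. R p q}" if "p \<in> A" for p
    using that by (meson not_le)
  then have "(\<Sum>p\<in>A. card A) \<le> (\<Sum>p\<in>A. 2 * card {q \<in> A. R p q})" by (rule sum_mono)
  also have "\<dots> = 2 * card (SIGMA p:A. {q \<in> A. R p q})"
    using assms by (simp add: sum_distrib_left)
  also have "(SIGMA p:A. {q \<in> A. R p q}) = {(p, q). p \<in> A \<and> q \<in> A \<and> R p q}" by auto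
  finally show False using assms by simp
qed

text \<open>\<open>X\<close> is a component of the graph without \<open>H\<close>. Fewer than half
  of the pairs of grid vertices have a coordinate-by-coordinate path using a line spoiled by
  \<open>H\<close>, so some \<open>p\<close> reaches more than half of the grid.\<close>

lemma spanner_crossbar_majority_component:
  fixes c :: real and G :: "(real ^ 'n::finite) pair_pre_digraph"
  assumes sp: "spanner c (crossbar C N) G w" and c: "c \<ge> 1"
    and C: "C \<subseteq> {..<N}" "C \<noteq> {}" and H: "finite H"
    and small: "2 * CARD('n) * card H * (5 * c) ^ (CARD('n) - 1) < card C ^ (CARD('n) - 1)"
  obtains X where "X \<subseteq> crossbar C N" "X \<inter> H = {}" "connected_in G X"
    "card (grid C :: ('n \<Rightarrow> nat) set) < 2 * card {f \<in> grid C. point f \<in> X}"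
proof -
  let ?d = "CARD('n)"
  let ?g = "grid C :: ('n \<Rightarrow> nat) set"
  interpret pair_graph G using sp by (simp add: spanner_def)
  have pg: "pair_graph G" ..
  have finC: "finite C" using C finite_subset by blast
  have N: "N > 0" using C by auto
  let ?thick = "\<lambda>f l Z. (\<lambda>t. point (f(l := t))) ` {..N - 1} \<subseteq> Z \<and> Z \<subseteq> crossbar C N \<and> connected_in G Z \<and>
      (\<forall>z\<in>Z. \<exists>t\<le>N - 1. dist (point (f(l := t))) z \<le> 2 * c)"
  define Z where "Z f l = (SOME Z. ?thick f l Z)" for f l
  have ex_thick: "\<exists>Z. ?thick f l Z" if f: "f \<in> ?g" for f l
  proof (rule spanner_thick_path[OF sp])
    show "point (f(l := i)) \<in> crossbar C N" if "i \<le> N - 1" for i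
      using that f N C unfolding crossbar_def by (intro imageI) (auto simp: PiE_iff)
    show "dist (point (f(l := i))) (point (f(l := Suc i))) = 1" for i
    proof -
      have "point (f(l := Suc i)) - point (f(l := i)) = axis l 1"
        by (auto simp: point_def vec_eq_iff axis_def)
      then show ?thesis by (metis dist_commute dist_norm norm_axis_1)
    qed
    show "c > 0" using c by simp
  qed
  have thick: "?thick f l (Z f l)" if "f \<in> ?g" for f l
    unfolding Z_def by (rule someI_ex[OF ex_thick[OF that]])
  have Z:
    "\<And>f l t. f \<in> ?g \<Longrightarrow> t \<le> N - 1 \<Longrightarrow> point (f(l := t)) \<in> Z f l"
    "\<And>f l. f \<in> ?g \<Longrightarrow> Z f l \<subseteq> crossbar C N"
    "\<And>f l. f \<in> ?g \<Longrightarrow> connected_in G (Z f l)"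
    "\<And>f l z. f \<in> ?g \<Longrightarrow> z \<in> Z f l \<Longrightarrow> \<exists>t\<le>N - 1. dist (point (f(l := t))) z \<le> 2 * c"
    using thick by (blast+)
  have Z_point: "point (f(l := t)) \<in> Z f l" if "f \<in> ?g" "t \<in> C" for f l t
  proof -
    have "t < N" using that(2) C by auto
    then show ?thesis using Z(1)[OF that(1), of t l] by simp
  qed
  \<comment> \<open>Spoiled lines are counted through the grid vertices on them, whence the factor
    \<open>card C\<close> in the bound.\<close>
  define Bad where "Bad l = {f \<in> ?g. Z f l \<inter> H \<noteq> {}}" for l
  have card_Bad: "card (Bad l) \<le> card H * card C * (5 * c) ^ (?d - 1)" for l
  proof -
    let ?S = "\<lambda>z. {f \<in> ?g. \<forall>l'. l' \<noteq> l \<longrightarrow> \<bar>real (f l') - z $ l'\<bar> \<le> 2 * c}"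
    have "Bad l \<subseteq> (\<Union>z\<in>H. ?S z)"
    proof
      fix f assume f: "f \<in> Bad l"
      then obtain z t where z: "z \<in> H" and "dist (point (f(l := t))) z \<le> 2 * c"
        using Z(4)[of f _ l] unfolding Bad_def by blast
      then have near: "\<bar>(point (f(l := t)) - z) $ l'\<bar> \<le> 2 * c" for l'
        using component_le_norm_cart[of "point (f(l := t)) - z" l'] by (simp add: dist_norm)
      have "\<bar>real (f l') - z $ l'\<bar> \<le> 2 * c" if "l' \<noteq> l" for l'
        using near[of l'] that by (simp add: point_def)
      then show "f \<in> (\<Union>z\<in>H. ?S z)" using f z by (auto simp: Bad_def)
    qed
    moreover have "finite (?S z)" for z
      using c by (intro card_grid_near_line(1)[OF finC]) simp
    ultimately have "card (Bad l) \<le> card (\<Union>z\<in>H. ?S z)"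
      using H by (intro card_mono finite_UN_I)
    also have "\<dots> \<le> (\<Sum>z\<in>H. card (?S z))" using H by (rule card_UN_le)
    finally have "real (card (Bad l)) \<le> real (\<Sum>z\<in>H. card (?S z))"
      by (rule of_nat_mono)
    also have "\<dots> = (\<Sum>z\<in>H. real (card (?S z)))"
      by (rule of_nat_sum)
    also have "\<dots> \<le> (\<Sum>z\<in>H. card C * (5 * c) ^ (?d - 1))"
    proof (rule sum_mono)
      fix z
      have "real (card (?S z)) \<le> card C * (2 * (2 * c) + 1) ^ (?d - 1)"
        using c by (intro card_grid_near_line(2)[OF finC]) simp
      \<comment> \<open>Here \<open>4 * c + 1 \<le> 5 * c\<close> because
        \<open>c \<ge> 1\<close>.\<close>
      also have "\<dots> \<le> card C * (5 * c) ^ (?d - 1)"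
        using c by (intro mult_left_mono power_mono) auto
      finally show "real (card (?S z)) \<le> card C * (5 * c) ^ (?d - 1)" .
    qed
    finally show ?thesis by (simp add: mult.assoc)
  qed
  obtain ls :: "'n list" where ls: "set ls = UNIV" "distinct ls"
    using finite_distinct_list[of "UNIV :: 'n set"] by auto
  have len: "length ls = ?d" using ls distinct_card[of ls] by simp
  let ?h = "\<lambda>i p q. interpolate (set (take i ls)) p q"
  \<comment> \<open>The path from \<open>p\<close> to \<open>q\<close> exchanges coordinates in the
    order of \<open>ls\<close>; its step \<open>i\<close> runs through \<open>?h i p q\<close> in
    direction \<open>ls ! i\<close>.\<close>
  define R where "R p q \<longleftrightarrow> (\<exists>i<?d. ?h i p q \<in> Bad (ls ! i))" for p q
  let ?pairs = "{(p, q). p \<in> ?g \<and> q \<in> ?g \<and> R p q}"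
  have few: "2 * card ?pairs < card ?g * card ?g"
  proof -
    let ?Q = "\<lambda>i. {(p, q). p \<in> ?g \<and> q \<in> ?g \<and> ?h i p q \<in> Bad (ls ! i)}"
    have "?pairs = (\<Union>i<?d. ?Q i)" unfolding R_def by auto
    then have "card ?pairs \<le> (\<Sum>i<?d. card (?Q i))"
      by (simp add: card_UN_le)
    also have "\<dots> \<le> (\<Sum>i<?d. card (Bad (ls ! i)) * card ?g)"
      using finC by (intro sum_mono card_interpolate_in) (auto simp: Bad_def)
    finally have "real (card ?pairs) \<le> real (\<Sum>i<?d. card (Bad (ls ! i)) * card ?g)"
      by (rule of_nat_mono)
    also have "\<dots> = (\<Sum>i<?d. real (card (Bad (ls ! i))) * card ?g)"
      unfolding of_nat_sum of_nat_mult ..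
    also have "\<dots> \<le> (\<Sum>i<?d. (card H * card C * (5 * c) ^ (?d - 1)) * card ?g)"
      using card_Bad by (intro sum_mono mult_right_mono) auto
    finally have "2 * real (card ?pairs) \<le> (2 * ?d * card H * (5 * c) ^ (?d - 1)) * card C * card ?g"
      by (simp add: mult_ac)
    \<comment> \<open>This is \<open>small\<close> multiplied by \<open>card C * card ?g\<close>.
      The right side is the square of \<open>card ?g\<close>, which equals
      \<open>card C ^ ?d\<close>.\<close>
    also have "\<dots> < real (card C ^ (?d - 1)) * real (card C) * real (card ?g)"
    proof (intro mult_strict_right_mono small)
      show "0 < real (card C)" "0 < real (card ?g)"
        using C finC by (simp_all add: card_gt_0_iff card_grid)
    qed
    also have "\<dots> = real (card ?g) * card ?g"
      using finC by (simp add: card_grid power_eq_if)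
    finally have "real (2 * card ?pairs) < real (card ?g * card ?g)" by simp
    then show ?thesis unfolding of_nat_less_iff .
  qed
  have "?g \<noteq> {}" using C by (auto simp: PiE_eq_empty_iff)
  then obtain p where p: "p \<in> ?g" "2 * card {q \<in> ?g. R p q} < card ?g"
    by (rule exists_small_section[OF finite_grid[OF finC] _ few])
  let ?X = "{y. (point p, y) \<in> avoiding G H}"
  let ?good = "{q \<in> ?g. \<not> R p q}"
  have "card ?g = card {q \<in> ?g. R p q} + card ?good"
    using finite_grid[OF finC, where 'n = 'n]
    by (subst card_Un_disjoint[symmetric]) (auto intro!: arg_cong[of _ _ card])
  with p(2) have big: "card ?g < 2 * card ?good" by simp
  \<comment> \<open>Any good \<open>q\<close> shows that the first line, which passes through
    \<open>p\<close>, is unspoiled. So \<open>point p\<close> is not in \<open>H\<close>, which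
    membership in \<open>?X\<close> alone would not give.\<close>
  then have "card ?good \<noteq> 0" by linarith
  then obtain q where "q \<in> ?g" "\<not> R p q"
    by (metis (no_types, lifting) card.empty ex_in_conv mem_Collect_eq)
  then have "?h 0 p q \<notin> Bad (ls ! 0)" unfolding R_def using zero_less_card_finite by blast
  then have "Z p (ls ! 0) \<inter> H = {}" using p(1) by (simp add: Bad_def interpolate_def)
  then have p_notin: "point p \<notin> H"
    using Z_point[OF p(1), of "p (ls ! 0)" "ls ! 0"] p(1) by (auto simp: PiE_iff)
  have p_in: "point p \<in> crossbar C N"
    using Z(2)[OF p(1)] Z_point[OF p(1), of "p (ls ! 0)" "ls ! 0"] p(1) by (auto simp: PiE_iff)
  have "point q \<in> ?X" if q: "q \<in> ?g" "\<not> R p q" for q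
  proof -
    have "(point p, point (?h i p q)) \<in> avoiding G H" if "i \<le> ?d" for i
      using that
    proof (induction i)
      case 0
      then show ?case by (simp add: interpolate_def)
    next
      case (Suc i)
      let ?f = "?h i p q" and ?l = "ls ! i"
      have f: "?f \<in> ?g" using p(1) q(1) by (auto simp: interpolate_def PiE_iff)
      have "?f \<notin> Bad ?l" using q(2) Suc.prems unfolding R_def by auto
      then have disj: "Z ?f ?l \<inter> H = {}" using f by (auto simp: Bad_def)
      have "?h (Suc i) p q = ?f(?l := q ?l)"
        using Suc.prems len by (auto simp: interpolate_def fun_eq_iff take_Suc_conv_app_nth)
      then have "point (?h (Suc i) p q) \<in> Z ?f ?l"
        using Z_point[OF f] q(1) by (auto simp: PiE_iff)
      moreover have "point ?f \<in> Z ?f ?l"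
        using Z_point[OF f, of "?f ?l" ?l] f by (auto simp: PiE_iff)
      ultimately have "(point ?f, point (?h (Suc i) p q)) \<in> avoiding G (- Z ?f ?l)"
        using Z(3)[OF f] unfolding connected_in_def by blast
      also have "avoiding G (- Z ?f ?l) \<subseteq> avoiding G H"
        using disj by (intro avoiding_mono) auto
      finally show ?case using Suc by (auto intro: rtrancl_trans)
    qed
    from this[of ?d] show ?thesis using len ls by (simp add: interpolate_def)
  qed
  then have "?good \<subseteq> {f \<in> ?g. point f \<in> ?X}" by auto
  then have "card ?good \<le> card {f \<in> ?g. point f \<in> ?X}"
    using finite_grid[OF finC, where 'n = 'n] by (intro card_mono) auto
  moreover have "y \<in> crossbar C N \<and> y \<notin> H" if "(point p, y) \<in> avoiding G H" for y
    using that by (cases rule: rtranclE) (use sp p_in p_notin in \<open>auto simp: spanner_def dest: in_arcsD2\<close>)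
  then have "?X \<subseteq> crossbar C N" "?X \<inter> H = {}" by auto
  moreover note connected_in_component[OF pg, of "point p" H]
  ultimately show ?thesis using that[of ?X] big by linarith
qed

lemma majorities_meet:
  assumes "finite A" "card A < 2 * card {x \<in> A. P x}" "card A < 2 * card {x \<in> A. Q x}"
  shows "\<exists>x\<in>A. P x \<and> Q x"
proof (rule ccontr)
  assume "\<not> ?thesis"
  then have "card {x \<in> A. P x} + card {x \<in> A. Q x} = card ({x \<in> A. P x} \<union> {x \<in> A. Q x})"
    using assms(1) by (intro card_Un_disjoint[symmetric]) auto
  also have "\<dots> \<le> card A" using assms(1) by (intro card_mono) auto
  finally show False using assms by simp
qed

text \<open>Connected sets with more than half of the grid vertices pairwise meet, so one bag meets
  them all. If the bound failed, this bag could be deleted as \<open>H\<close>, and a majority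
  component would remain that it misses.\<close>

lemma spanner_crossbar_treewidth:
  fixes c :: real and G :: "(real ^ 'n::finite) pair_pre_digraph"
  assumes sp: "spanner c (crossbar C N) G w" and c: "c \<ge> 1"
    and C: "C \<subseteq> {..<N}" "C \<noteq> {}"
  shows "card C ^ (CARD('n) - 1) \<le> 2 * CARD('n) * treewidth G * (5 * c) ^ (CARD('n) - 1)"
proof (rule ccontr)
  let ?g = "grid C :: ('n \<Rightarrow> nat) set"
  assume A: "\<not> ?thesis"
  have pg: "pair_graph G" and P: "pverts G = crossbar C N" using sp by (simp_all add: spanner_def)
  interpret pair_graph G by fact
  obtain T :: "nat pair_pre_digraph" and V where td: "tree_decomposition G T V" and tw: "width T V = treewidth G"
    using treewidth_attained[OF pg] by blast
  have T: "pair_graph T" "pverts T \<noteq> {}"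
    using td unfolding tree_decomposition_def undirected_tree_def connected_def strongly_connected_def
    by (auto simp: mk_symmetric_def)
  then interpret T: pair_graph T by simp
  define \<B> where "\<B> = {X. X \<subseteq> crossbar C N \<and> connected_in G X \<and>
      card ?g < 2 * card {f \<in> ?g. point f \<in> X}}"
  have finC: "finite C" using C finite_subset by blast
  obtain t where t: "t \<in> pverts T" "\<And>X. X \<in> \<B> \<Longrightarrow> V t \<inter> X \<noteq> {}"
  proof (rule tree_decomposition_bag_hits_all[OF td T(2), of \<B>])
    show "X \<inter> Y \<noteq> {}" if "X \<in> \<B>" "Y \<in> \<B>" for X Y
      using majorities_meet[OF finite_grid[OF finC], of "\<lambda>f. point f \<in> X" "\<lambda>f. point f \<in> Y"] that
      unfolding \<B>_def by auto
  qed (auto simp: \<B>_def P)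
  have "V t \<subseteq> pverts G" using td t(1) unfolding tree_decomposition_def by auto
  then have finV: "finite (V t)" using pair_finite_verts finite_subset by blast
  have "card (V t) \<le> treewidth G"
    using tw t(1) T.pair_finite_verts by (auto simp: width_def intro!: Max_ge simp flip: tw)
  then have "2 * CARD('n) * card (V t) * (5 * c) ^ (CARD('n) - 1)
      \<le> 2 * CARD('n) * treewidth G * (5 * c) ^ (CARD('n) - 1)"
    using c by (intro mult_right_mono) auto
  also have "\<dots> < card C ^ (CARD('n) - 1)" using A by simp
  finally show False
  proof (rule spanner_crossbar_majority_component[OF sp c C finV])
    fix X assume "X \<subseteq> crossbar C N" "X \<inter> V t = {}" "connected_in G X"
      "card ?g < 2 * card {f \<in> ?g. point f \<in> X}"
    then show False using t(2)[of X] unfolding \<B>_def by blast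
  qed
qed

section \<open>Size of the crossbar\<close>

lemma finite_crossbar: "finite (crossbar C N :: (real ^ 'n::finite) set)"
  unfolding crossbar_def
proof (rule finite_imageI, rule finite_subset)
  show "{f. (\<forall>l. f l < N) \<and> (\<exists>l0. \<forall>l. l \<noteq> l0 \<longrightarrow> f l \<in> C)} \<subseteq> (UNIV :: 'n set) \<rightarrow>\<^sub>E {..<N}"
    by (auto simp: PiE_iff)
qed (simp add: finite_PiE)

lemma card_crossbar_le:
  assumes "finite C"
  shows "card (crossbar C N :: (real ^ 'n::finite) set) \<le> CARD('n) * N * card C ^ (CARD('n) - 1)"
proof -
  let ?F = "\<lambda>l0. PiE UNIV (\<lambda>l::'n. if l = l0 then {..<N} else C)"
  have "crossbar C N \<subseteq> (\<Union>l0. point ` ?F l0)"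
  proof
    fix y :: "real ^ 'n" assume "y \<in> crossbar C N"
    then obtain f l0 where "y = point f" "\<forall>l. f l < N" "\<forall>l. l \<noteq> l0 \<longrightarrow> f l \<in> C"
      unfolding crossbar_def by auto
    moreover from this have "f \<in> ?F l0" by (auto simp: PiE_iff)
    ultimately show "y \<in> (\<Union>l0. point ` ?F l0)" by blast
  qed
  then have "card (crossbar C N :: (real ^ 'n) set) \<le> card (\<Union>l0. point ` ?F l0)"
    using assms by (intro card_mono) (auto intro!: finite_PiE)
  also have "\<dots> \<le> (\<Sum>l0\<in>UNIV. card (point ` ?F l0))" by (rule card_UN_le) simp
  also have "\<dots> \<le> (\<Sum>l0\<in>(UNIV::'n set). N * card C ^ (CARD('n) - 1))"
  proof (rule sum_mono)
    fix l0 :: 'n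
    have "card (point ` ?F l0) \<le> card (?F l0)"
      using assms by (intro card_image_le finite_PiE) auto
    also have "\<dots> = N * card C ^ (CARD('n) - 1)"
      by (simp add: card_PiE prod.remove[of UNIV l0])
    finally show "card (point ` ?F l0) \<le> N * card C ^ (CARD('n) - 1)" .
  qed
  finally show ?thesis by simp
qed

text \<open>A single line already has \<open>N\<close> points; its direction
  \<open>undefined\<close> stands for an arbitrary coordinate.\<close>

lemma card_crossbar_ge:
  assumes "x \<in> C" "x < N"
  shows "N \<le> card (crossbar C N :: (real ^ 'n::finite) set)"
proof -
  let ?L = "\<lambda>t. point ((\<lambda>_::'n. x)(undefined := t))"
  have "card {..<N} \<le> card (crossbar C N :: (real ^ 'n::finite) set)"
  proof (rule card_inj_on_le[where f = ?L])
    have "inj ?L"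
    proof (rule injI)
      fix s t assume "?L s = ?L t"
      then have "(\<lambda>_::'n. x)(undefined := s) = (\<lambda>_. x)(undefined := t)"
        by (rule injD[OF inj_point])
      then show "s = t" by (metis fun_upd_same)
    qed
    then show "inj_on ?L {..<N}" by (rule inj_on_subset) simp
    show "?L ` {..<N} \<subseteq> crossbar C N"
      using assms unfolding crossbar_def by (auto intro!: imageI exI[of _ undefined])
  qed (rule finite_crossbar)
  then show ?thesis by simp
qed

section \<open>Dimension\<close>

definition digit_set :: "nat \<Rightarrow> nat \<Rightarrow> nat set" where
  "digit_set a b = {y. \<forall>i. y div b ^ i mod b < a}"

lemma digit_set_div: "y \<in> digit_set a b \<Longrightarrow> y div b ^ i \<in> digit_set a b"
  by (simp add: digit_set_def flip: div_mult2_eq power_add)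

lemma digit_set_mod: "y \<in> digit_set a b \<Longrightarrow> y mod b < a"
  by (auto simp: digit_set_def dest: spec[of _ 0])

lemma digit_set_full: "b > 0 \<Longrightarrow> digit_set b b = UNIV"
  by (auto simp: digit_set_def)

text \<open>The quotient fixes all digits but the lowest \<open>l\<close>, and each of these has at
  most \<open>a\<close> values. The induction splits off the last digit.\<close>

lemma digit_set_prefix:
  assumes "b > 0"
  shows "finite {z \<in> digit_set a b. z div b ^ l = q} \<and> card {z \<in> digit_set a b. z div b ^ l = q} \<le> a ^ l"
proof (induction l)
  case 0
  have "{z \<in> digit_set a b. z div b ^ 0 = q} \<subseteq> {q}" by auto
  then show ?case
    using card_mono[of "{q}"] finite_subset by fastforce
next
  case (Suc l)
  let ?S = "\<lambda>l. {z \<in> digit_set a b. z div b ^ l = q}"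
  let ?\<phi> = "\<lambda>z. (z div b, z mod b)"
  have sub: "?\<phi> ` ?S (Suc l) \<subseteq> ?S l \<times> {..<a}"
    using digit_set_div[of _ a b 1] digit_set_mod by (auto simp: div_mult2_eq)
  have inj: "inj_on ?\<phi> (?S (Suc l))"
    by (rule inj_onI) (metis div_mult_mod_eq prod.inject)
  have fin: "finite (?S l \<times> {..<a})" using Suc by auto
  have "card (?S (Suc l)) \<le> card (?S l \<times> {..<a})"
    by (rule card_inj_on_le[OF inj sub fin])
  also have "\<dots> = card (?S l) * a" by (simp add: card_cartesian_product)
  also have "\<dots> \<le> a ^ l * a" using Suc by (intro mult_right_mono) auto
  finally have "card (?S (Suc l)) \<le> a ^ Suc l" by (simp add: mult.commute)
  moreover have "finite (?S (Suc l))" by (rule inj_on_finite[OF inj sub fin])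
  ultimately show ?case by blast
qed

text \<open>Appending a digit \<open>t < a\<close> is injective because
  \<open>t < b\<close>.\<close>

lemma card_digit_set_ge:
  assumes "a \<le> b" "0 < a"
  shows "a ^ k \<le> card (digit_set a b \<inter> {..<b ^ k})"
proof (induction k)
  case 0
  have "digit_set a b \<inter> {..<b ^ 0} = {0}" using assms by (auto simp: digit_set_def)
  then show ?case by simp
next
  case (Suc k)
  let ?D = "\<lambda>k. digit_set a b \<inter> {..<b ^ k}"
  let ?\<phi> = "\<lambda>(y, t). b * y + t"
  have "a ^ Suc k \<le> card (?D k) * a" using Suc by simp
  also have "\<dots> = card (?D k \<times> {..<a})" by (simp add: card_cartesian_product)
  also have "\<dots> \<le> card (?D (Suc k))"
  proof (rule card_inj_on_le[where f = ?\<phi>])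
    show "inj_on ?\<phi> (?D k \<times> {..<a})"
    proof (rule inj_onI, clarify)
      fix y t y' t' assume "t < a" "t' < a" and eq: "b * y + t = b * y' + t'"
      then have t: "t < b" "t' < b" using assms by auto
      have "y = (b * y + t) div b" "y' = (b * y' + t') div b" using t by simp_all
      then show "y = y' \<and> t = t'" using eq by simp
    qed
    show "?\<phi> ` (?D k \<times> {..<a}) \<subseteq> ?D (Suc k)"
    proof clarify
      fix y t assume y: "y \<in> digit_set a b" "y < b ^ k" and "t < a"
      then have t: "t < b" using assms by simp
      have "(b * y + t) div b ^ i mod b < a" for i
        using y(1) t \<open>t < a\<close>
        by (cases i) (auto simp: digit_set_def div_mult2_eq)
      moreover have "b * y + t < b ^ Suc k"
      proof -
        have "b * y + t < b * (y + 1)" using t by simp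
        also have "\<dots> \<le> b * b ^ k" using y(2) by (intro mult_left_mono) auto
        finally show ?thesis by simp
      qed
      ultimately show "b * y + t \<in> ?D (Suc k)" by (simp add: digit_set_def)
    qed
  qed simp
  finally show ?case .
qed

lemma card_digit_set_eq:
  assumes "a \<le> b" "0 < a"
  shows "card (digit_set a b \<inter> {..<b ^ k}) = a ^ k"
proof (rule antisym)
  have "digit_set a b \<inter> {..<b ^ k} = {z \<in> digit_set a b. z div b ^ k = 0}"
    using assms by (auto simp: div_eq_0_iff)
  then show "card (digit_set a b \<inter> {..<b ^ k}) \<le> a ^ k"
    using digit_set_prefix[of b a k 0] assms by simp
qed (rule card_digit_set_ge[OF assms])

text \<open>The window has length at most \<open>b ^ j\<close>, so its elements lie in two
  consecutive blocks of that length: the block of the least element \<open>y0\<close> and the next.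
  Within a block, a cell of side \<open>b ^ i\<close> is determined by \<open>j - i\<close>
  digits.\<close>

lemma digit_set_cells:
  fixes a b :: nat and x R :: real
  assumes "b > 0" "i \<le> j" "2 * R \<le> real b ^ j"
  defines "S \<equiv> (\<lambda>y. y div b ^ i) ` {y \<in> digit_set a b. \<bar>real y - x\<bar> \<le> R}"
  shows "finite S" "card S \<le> 2 * a ^ (j - i)"
proof -
  let ?Y = "{y \<in> digit_set a b. \<bar>real y - x\<bar> \<le> R}"
  let ?F = "\<lambda>q. {z \<in> digit_set a b. z div b ^ (j - i) = q}"
  obtain q where q: "S \<subseteq> ?F q \<union> ?F (Suc q)"
  proof (cases "?Y = {}")
    case True
    then show ?thesis using that S_def by auto
  next
    case False
    define y0 where "y0 = (LEAST y. y \<in> ?Y)"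
    have y0: "y0 \<in> ?Y" "\<And>y. y \<in> ?Y \<Longrightarrow> y0 \<le> y"
      using False LeastI_ex[of "\<lambda>y. y \<in> ?Y"] Least_le[of "\<lambda>y. y \<in> ?Y"] unfolding y0_def by blast+
    have "S \<subseteq> ?F (y0 div b ^ j) \<union> ?F (Suc (y0 div b ^ j))"
    proof
      fix z assume "z \<in> S"
      then obtain y where y: "y \<in> ?Y" "z = y div b ^ i" unfolding S_def by auto
      have "real y \<le> real y0 + 2 * R" using y(1) y0(1) by auto
      also have "\<dots> \<le> real (y0 + b ^ j)" using assms(3) by simp
      finally have "y \<le> y0 + b ^ j" by linarith
      then have "y div b ^ j \<le> (y0 + b ^ j) div b ^ j" by (rule div_le_mono)
      also have "\<dots> = Suc (y0 div b ^ j)" using assms(1) by simp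
      finally have "y div b ^ j \<le> Suc (y0 div b ^ j)" .
      moreover have "y0 div b ^ j \<le> y div b ^ j" using y0(2)[OF y(1)] by (rule div_le_mono)
      moreover have "z div b ^ (j - i) = y div b ^ j"
        using assms(2) y(2) by (simp flip: div_mult2_eq power_add)
      moreover have "z \<in> digit_set a b" using y digit_set_div by auto
      ultimately show "z \<in> ?F (y0 div b ^ j) \<union> ?F (Suc (y0 div b ^ j))" by auto
    qed
    then show ?thesis by (rule that)
  qed
  have F: "finite (?F q)" "card (?F q) \<le> a ^ (j - i)" for q
    using digit_set_prefix[OF assms(1)] by blast+
  show "finite S" using q F(1) finite_subset by blast
  have "card S \<le> card (?F q \<union> ?F (Suc q))" using q F(1) by (intro card_mono) auto
  also have "\<dots> \<le> card (?F q) + card (?F (Suc q))" by (rule card_Un_le)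
  finally show "card S \<le> 2 * a ^ (j - i)" using F(2)[of q] F(2)[of "Suc q"] by linarith
qed

text \<open>A cell of side \<open>b ^ i\<close> holds at most one point of \<open>M\<close>: its
  points are at distance at most \<open>CARD('n) * b ^ i \<le> \<rho>\<close>, or
  \<open>i = 0\<close> and it is a single point. So it suffices to count cells, for each choice of
  the exceptional coordinate.\<close>

lemma card_separated_crossbar_le:
  fixes M :: "(real ^ 'n::finite) set" and \<rho> r :: real
  assumes C: "C \<subseteq> digit_set a b" and b: "b > 0"
    and M: "M \<subseteq> crossbar C N" "\<And>x y. x \<in> M \<Longrightarrow> y \<in> M \<Longrightarrow> x \<noteq> y \<Longrightarrow> dist x y > \<rho>"
    and ij: "i = 0 \<or> CARD('n) * real b ^ i \<le> \<rho>" "i \<le> j" "2 * r \<le> real b ^ j"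
  shows "card (M \<inter> cball x r) \<le> CARD('n) * 2 ^ CARD('n) * (b * a ^ (CARD('n) - 1)) ^ (j - i)"
proof -
  let ?d = "CARD('n)"
  let ?cell = "\<lambda>f l. f l div b ^ i"
  let ?I = "\<lambda>a l. (\<lambda>y. y div b ^ i) ` {y \<in> digit_set a b. \<bar>real y - x $ l\<bar> \<le> r}"
  \<comment> \<open>The exceptional coordinate \<open>l0\<close> is also handled by digits, all of
    them allowed, as \<open>digit_set b b = UNIV\<close>.\<close>
  let ?Q = "\<lambda>l0. PiE UNIV (\<lambda>l. if l = l0 then ?I b l else ?I a l)"
  define A where "A = {f. point f \<in> M \<inter> cball x r}"
  have I: "finite (?I a l)" "card (?I a l) \<le> 2 * a ^ (j - i)" for a l
    using digit_set_cells[OF b ij(2,3), of a "x $ l"] by blast+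
  have "M \<inter> cball x r = point ` A"
    using M(1) by (auto simp: A_def crossbar_def)
  then have "card (M \<inter> cball x r) = card A"
    using card_image[OF inj_on_subset[OF inj_point]] by auto
  also have "\<dots> \<le> card (\<Union>l0. ?Q l0)"
  proof (rule card_inj_on_le[where f = ?cell])
    show "inj_on ?cell A"
    proof (rule inj_onI, rule ccontr)
      fix f g assume fg: "f \<in> A" "g \<in> A" "?cell f = ?cell g" "f \<noteq> g"
      have near: "\<bar>real (f l) - real (g l)\<bar> \<le> real b ^ i" and "i = 0 \<Longrightarrow> f l = g l" for l
      proof -
        have eq: "f l div b ^ i = g l div b ^ i" using fg(3) by (rule fun_cong)
        then show "i = 0 \<Longrightarrow> f l = g l" by simp
        have "f l = f l div b ^ i * b ^ i + f l mod b ^ i"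
          by (rule div_mult_mod_eq[symmetric])
        moreover have "g l = f l div b ^ i * b ^ i + g l mod b ^ i"
          unfolding eq by (rule div_mult_mod_eq[symmetric])
        moreover have "f l mod b ^ i < b ^ i" "g l mod b ^ i < b ^ i" using b by auto
        ultimately have "f l < g l + b ^ i" "g l < f l + b ^ i" by linarith+
        then have "real (f l) < real (g l + b ^ i)" "real (g l) < real (f l + b ^ i)"
          unfolding of_nat_less_iff by auto
        then show "\<bar>real (f l) - real (g l)\<bar> \<le> real b ^ i" by simp
      qed
      then have "i \<noteq> 0" using fg(4) by auto
      have "dist (point f) (point g) \<le> (\<Sum>l\<in>UNIV. \<bar>(point f - point g) $ l\<bar>)"
        unfolding dist_norm by (rule norm_le_l1_cart)
      also have "\<dots> \<le> (\<Sum>l\<in>(UNIV::'n set). real b ^ i)"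
        using near by (intro sum_mono) (simp add: point_def)
      also have "\<dots> \<le> \<rho>" using ij(1) \<open>i \<noteq> 0\<close> by simp
      finally have "dist (point f) (point g) \<le> \<rho>" .
      moreover have "point f \<noteq> point g" using fg(4) injD[OF inj_point] by blast
      ultimately show False using M(2) fg(1,2) unfolding A_def by force
    qed
    show "?cell ` A \<subseteq> (\<Union>l0. ?Q l0)"
    proof clarify
      fix f assume f: "f \<in> A"
      then obtain l0 where l0: "\<And>l. l \<noteq> l0 \<Longrightarrow> f l \<in> C"
        using M(1) injD[OF inj_point] unfolding A_def crossbar_def by blast
      have "\<bar>real (f l) - x $ l\<bar> \<le> r" for l
      proof -
        have "\<bar>(point f - x) $ l\<bar> \<le> norm (point f - x)" by (rule component_le_norm_cart)
        also have "\<dots> \<le> r" using f by (simp add: A_def dist_norm norm_minus_commute)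
        finally show ?thesis by (simp add: point_def)
      qed
      then have "?cell f \<in> ?Q l0"
        using l0 C digit_set_full[OF b] by (auto simp: PiE_iff)
      then show "?cell f \<in> (\<Union>l0. ?Q l0)" by blast
    qed
    show "finite (\<Union>l0. ?Q l0)" using I(1) by (auto intro!: finite_PiE)
  qed
  also have "\<dots> \<le> (\<Sum>l0\<in>UNIV. card (?Q l0))" by (rule card_UN_le) simp
  also have "\<dots> \<le> (\<Sum>l0\<in>(UNIV::'n set). 2 ^ ?d * (b * a ^ (?d - 1)) ^ (j - i))"
  proof (rule sum_mono)
    fix l0 :: 'n
    have "card (?Q l0) = card (?I b l0) * (\<Prod>l\<in>UNIV - {l0}. card (?I a l))"
      by (simp add: card_PiE prod.remove[of UNIV l0])
    also have "\<dots> \<le> (2 * b ^ (j - i)) * (\<Prod>l\<in>UNIV - {l0}. 2 * a ^ (j - i))"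
      using I(2) by (intro mult_mono prod_mono) auto
    also have "\<dots> = (2 * 2 ^ (?d - 1)) * (b ^ (j - i) * (a ^ (j - i)) ^ (?d - 1))"
      by (simp add: power_mult_distrib)
    also have "b ^ (j - i) * (a ^ (j - i)) ^ (?d - 1) = (b * a ^ (?d - 1)) ^ (j - i)"
      by (simp add: power_mult_distrib mult.commute flip: power_mult)
    also have "2 * 2 ^ (?d - 1) = (2 :: nat) ^ ?d" by (simp flip: power_Suc)
    finally show "card (?Q l0) \<le> 2 ^ ?d * (b * a ^ (?d - 1)) ^ (j - i)" .
  qed
  finally show ?thesis by (simp add: mult.assoc)
qed

section \<open>From cell counts to the fractal dimension\<close>

lemma powr_power_commute: "x > 0 \<Longrightarrow> (x powr s) ^ n = (x ^ n) powr s" for x s :: real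
  by (simp add: powr_powr mult.commute flip: powr_realpow)

text \<open>Take the largest \<open>i\<close> with \<open>D * b ^ i \<le> \<rho>\<close> and the
  least \<open>j\<close> with \<open>2 * r \<le> b ^ j\<close>, as far as they exist and are in
  order. Rounding to powers of \<open>b\<close> costs a factor \<open>b\<close> each time, whence
  the square.\<close>

lemma obtain_scales:
  fixes \<rho> r D :: real
  assumes "b \<ge> 2" "\<rho> > 0" "r \<ge> 2 * \<rho>" "D \<ge> 1"
  obtains i j where "i = 0 \<or> D * real b ^ i \<le> \<rho>" "i \<le> j" "2 * r \<le> real b ^ j"
    "real b ^ (j - i) \<le> 2 * D * (real b)\<^sup>2 * (r / \<rho>)"
proof -
  have b: "real b > 1" using assms(1) by simp
  define k where "k = (LEAST k. \<rho> < D * real b ^ k)"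
  \<comment> \<open>If \<open>k = 0\<close>, truncated subtraction gives \<open>i = 0\<close>, the
    first alternative of the conclusion.\<close>
  define i where "i = k - 1"
  define m where "m = (LEAST m. 2 * r \<le> real b ^ m)"
  obtain k0 where "\<rho> < real b ^ k0" using real_arch_pow[OF b] by blast
  also have "real b ^ k0 \<le> D * real b ^ k0" using assms(4) b by simp
  finally have k: "\<rho> < D * real b ^ k" unfolding k_def by (rule LeastI)
  have lower: "D * real b ^ i \<le> \<rho>" if "i \<noteq> 0"
  proof -
    have "i < k" using that by (simp add: i_def)
    from not_less_Least[OF this[unfolded k_def]] show ?thesis by simp
  qed
  obtain m0 where "2 * r < real b ^ m0" using real_arch_pow[OF b] by blast
  then have "2 * r \<le> real b ^ m0" by simp
  then have m: "2 * r \<le> real b ^ m" unfolding m_def by (rule LeastI)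
  have "D * real b ^ k \<le> D * real b ^ Suc i"
    using b assms(4) by (intro mult_left_mono power_increasing) (auto simp: i_def)
  with k have upper: "\<rho> < D * real b * real b ^ i" by (simp add: mult.assoc)
  have "1 \<le> D * (real b)\<^sup>2"
    using mult_mono[of 1 D 1 "(real b)\<^sup>2"] assms(4) b by simp
  have rho: "2 \<le> r / \<rho>" using assms(2,3) by (simp add: field_simps)
  show ?thesis
  proof (cases "m \<le> i")
    case True
    \<comment> \<open>Here \<open>j = i\<close> suffices, and the ratio of the scales is 1.\<close>
    have "2 * r \<le> real b ^ i" using m power_increasing[OF True, of "real b"] b by linarith
    moreover have "1 * 1 \<le> (2 * D * (real b)\<^sup>2) * (r / \<rho>)"
      using \<open>1 \<le> D * (real b)\<^sup>2\<close> rho by (intro mult_mono) auto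
    ultimately show ?thesis using that[of i i] lower by auto
  next
    case False
    have "\<not> 2 * r \<le> real b ^ (m - 1)"
    proof -
      have "m - 1 < m" using False by simp
      then show ?thesis unfolding m_def by (rule not_less_Least)
    qed
    then have "real b * real b ^ (m - 1) \<le> real b * (2 * r)" using b by (intro mult_left_mono) auto
    then have "real b ^ m \<le> 2 * r * real b" using False by (simp add: power_eq_if mult_ac)
    then have "real b ^ (m - i) * real b ^ i \<le> 2 * r * real b"
      using False by (simp flip: power_add)
    then have "real b ^ (m - i) * \<rho> \<le> 2 * D * (real b)\<^sup>2 * r"
    proof -
      have "real b ^ (m - i) * \<rho> \<le> real b ^ (m - i) * (D * real b * real b ^ i)"
        using upper by (intro mult_left_mono) auto
      also have "\<dots> = (real b ^ (m - i) * real b ^ i) * (D * real b)" by (simp add: mult_ac)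
      also have "\<dots> \<le> (2 * r * real b) * (D * real b)"
        using \<open>real b ^ (m - i) * real b ^ i \<le> 2 * r * real b\<close> assms(4)
        by (intro mult_right_mono) auto
      finally show ?thesis by (simp add: power2_eq_square mult_ac)
    qed
    then have "real b ^ (m - i) \<le> 2 * D * (real b)\<^sup>2 * (r / \<rho>)"
      using assms(2) by (simp add: field_simps)
    then show ?thesis using that[of i m] lower m False by auto
  qed
qed

text \<open>The equation for \<open>s\<close> turns the cell count
  \<open>(b * a ^ (CARD('n) - 1)) ^ (j - i)\<close> into \<open>(b ^ (j - i)) powr s\<close>, at
  most a constant times \<open>(r / \<rho>) powr s\<close>. The constant depends on
  \<open>b\<close>, \<open>s\<close> and the dimension only, so it is uniform over the
  family.\<close>

lemma fractal_dim_crossbars_le: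
  fixes \<P> :: "(real ^ 'n::finite) set set" and s :: real
  assumes b: "b \<ge> 2" and s: "s \<ge> 0" "real b powr s = real (b * a ^ (CARD('n) - 1))"
    and \<P>: "\<And>P. P \<in> \<P> \<Longrightarrow> \<exists>C N. C \<subseteq> digit_set a b \<and> P = crossbar C N"
  shows "fractal_dim \<P> \<le> ereal s"
proof -
  let ?d = "CARD('n)"
  let ?K = "2 * real ?d * (real b)\<^sup>2"
  have "real (card (M \<inter> cball x r)) \<le> (real ?d * 2 ^ ?d * ?K powr s) * (r / \<rho>) powr s"
    if prem: "P \<in> \<P>" "\<rho> > 0" "r \<ge> 2 * \<rho>" "rho_net \<rho> P M" for P \<rho> r M and x :: "real ^ 'n"
  proof -
    obtain C N where C: "C \<subseteq> digit_set a b" "P = crossbar C N" using \<P>[OF prem(1)] by blast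
    have "real ?d \<ge> 1" by (simp add: Suc_leI)
    from obtain_scales[OF b prem(2,3) this] obtain i j where
      ij: "i = 0 \<or> real ?d * real b ^ i \<le> \<rho>" "i \<le> j" "2 * r \<le> real b ^ j"
        "real b ^ (j - i) \<le> ?K * (r / \<rho>)"
      by metis
    have "card (M \<inter> cball x r) \<le> ?d * 2 ^ ?d * (b * a ^ (?d - 1)) ^ (j - i)"
      using prem(4) C b ij unfolding rho_net_def
      by (intro card_separated_crossbar_le[of C a b M N \<rho>]) auto
    then have "real (card (M \<inter> cball x r)) \<le> real (?d * 2 ^ ?d * (b * a ^ (?d - 1)) ^ (j - i))"
      by (rule of_nat_mono)
    also have "\<dots> = real ?d * 2 ^ ?d * real (b * a ^ (?d - 1)) ^ (j - i)" by simp
    also have "real (b * a ^ (?d - 1)) ^ (j - i) = (real b ^ (j - i)) powr s"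
      unfolding s(2)[symmetric] using b by (intro powr_power_commute) simp
    also have "real ?d * 2 ^ ?d * (real b ^ (j - i)) powr s \<le> real ?d * 2 ^ ?d * (?K * (r / \<rho>)) powr s"
      using ij(4) s(1) by (intro mult_left_mono powr_mono2) auto
    also have "(?K * (r / \<rho>)) powr s = ?K powr s * (r / \<rho>) powr s"
      by (rule powr_mult)
    finally show ?thesis by (simp add: mult.assoc)
  qed
  then have "ereal s \<in> {ereal s |s. \<exists>C::real.
     \<forall>P\<in>\<P>. \<forall>\<rho>>0. \<forall>r\<ge>2 * \<rho>. \<forall>N x.
       rho_net \<rho> P N \<longrightarrow> real (card (N \<inter> cball x r)) \<le> C * (r / \<rho>) powr s}"
    by blast
  then show ?thesis unfolding fractal_dim_def by (rule Inf_lower)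
qed

section \<open>The lower bound\<close>

theorem theorem1p1:
  fixes \<delta> \<epsilon> :: real
  assumes "CARD('n::finite) \<ge> 2"
    and "1 < \<delta>" and "\<delta> < real CARD('n)" and "\<epsilon> > 0"
  shows "\<exists>(\<delta>' :: real) (\<kappa> :: real) (\<P> :: (real ^ 'n) set set).
    \<bar>\<delta> - \<delta>'\<bar> \<le> \<epsilon> \<and> \<kappa> > 0 \<and>
    (\<forall>P\<in>\<P>. finite P) \<and> fractal_dim \<P> \<le> ereal \<delta>' \<and>
    (\<forall>n\<^sub>0 :: nat. \<exists>P\<in>\<P>. card P \<ge> n\<^sub>0 \<and>
      (\<forall>(c :: real) (G :: (real ^ 'n) pair_pre_digraph) w.
        c \<ge> 1 \<and> spanner c P G w \<longrightarrow>
        real (treewidth G) \<ge>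
          \<kappa> * (real (card P) powr (1 - 1 / \<delta>') / c ^ (CARD('n) - 1))))"
proof -
  let ?d = "CARD('n)"
  define D where "D = real (?d - 1)"
  have D: "D \<ge> 1" "real ?d = D + 1" using assms(1) by (auto simp: D_def)
  \<comment> \<open>The target value for the Cantor dimension \<open>ln a / ln b\<close>.\<close>
  define \<alpha> where "\<alpha> = (\<delta> - 1) / D"
  have \<alpha>: "0 < \<alpha>" "\<alpha> < 1" "\<delta> = 1 + D * \<alpha>" using assms D by (auto simp: \<alpha>_def field_simps)
  \<comment> \<open>\<open>M\<close> will be the denominator of an approximation
    \<open>s / M\<close> to \<alpha>. An error of \<open>1 / M\<close> there changes the exponent by
    \<open>D / M \<le> \<epsilon>\<close>.\<close>
  obtain M0 where M0: "D / \<epsilon> < real M0" using reals_Archimedean2 by blast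
  define M where "M = Suc M0"
  have M: "M > 0" "D / M \<le> \<epsilon>"
  proof -
    have "D / \<epsilon> \<le> real M" using M0 by (simp add: M_def)
    then show "D / M \<le> \<epsilon>" using assms(4) by (simp add: M_def field_simps)
  qed (simp add: M_def)
  define s where "s = nat \<lfloor>\<alpha> * M\<rfloor>"
  have s_eq: "real s = of_int \<lfloor>\<alpha> * M\<rfloor>" using \<alpha>(1) by (simp add: s_def)
  have s: "real s \<le> \<alpha> * M" "\<alpha> * M < real s + 1" unfolding s_eq by linarith+
  have "\<alpha> * real M \<le> 1 * real M" using \<alpha>(2) by (intro mult_right_mono) auto
  then have "s \<le> M" using s by linarith
  \<comment> \<open>With these powers of 2, \<open>ln a / ln b\<close> is exactly
    \<open>s / M\<close>. If \<open>s = 0\<close>, only the digit 0 is allowed and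
    \<open>\<delta>'\<close> is 1.\<close>
  define a b :: nat where "a = 2 ^ s" and "b = 2 ^ M"
  have "2 ^ 1 \<le> (2::nat) ^ M" using M by (intro power_increasing) auto
  then have ab: "a \<le> b" "0 < a" "2 \<le> b"
    using \<open>s \<le> M\<close> by (auto simp: a_def b_def intro: power_increasing)
  define \<delta>' where "\<delta>' = 1 + D * (real s / M)"
  have "\<delta>' \<ge> 1" using D by (simp add: \<delta>'_def)
  have close: "\<bar>\<delta> - \<delta>'\<bar> \<le> \<epsilon>"
  proof -
    have "\<delta> - \<delta>' = D * (\<alpha> - real s / M)" by (simp add: \<alpha>(3) \<delta>'_def algebra_simps)
    moreover have "real s / M \<le> \<alpha>" "\<alpha> \<le> (real s + 1) / M"
      using s M(1) by (simp_all add: pos_divide_le_eq pos_le_divide_eq)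
    then have "0 \<le> \<alpha> - real s / M" "\<alpha> - real s / M \<le> 1 / M"
      by (simp_all add: add_divide_distrib)
    then have "0 \<le> D * (\<alpha> - real s / M)" "D * (\<alpha> - real s / M) \<le> D * (1 / M)"
      using D(1) by (simp, intro mult_left_mono) auto
    ultimately show ?thesis using M(2) by simp
  qed
  have powr: "real b powr \<delta>' = real (b * a ^ (?d - 1))"
  proof -
    have "real b powr \<delta>' = 2 powr (real M * \<delta>')"
      by (simp add: b_def powr_powr flip: powr_realpow)
    also have "real M * \<delta>' = real (M + s * (?d - 1))"
      using M(1) by (simp add: \<delta>'_def D_def field_simps)
    also have "2 powr real (M + s * (?d - 1)) = 2 ^ (M + s * (?d - 1))"
      by (rule powr_realpow) simp
    also have "\<dots> = real (b * a ^ (?d - 1))" by (simp add: a_def b_def power_add power_mult)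
    finally show ?thesis .
  qed
  define C where "C k = digit_set a b \<inter> {..<b ^ k}" for k
  define \<P> :: "(real ^ 'n) set set" where "\<P> = range (\<lambda>k. crossbar (C k) (b ^ k))"
  \<comment> \<open>The treewidth bound contributes \<open>2 * ?d * 5 ^ (?d - 1)\<close>, and the
    estimate for the number of points contributes the other factor \<open>?d\<close>.\<close>
  define \<kappa> where "\<kappa> = 1 / (2 * real ?d ^ 2 * 5 ^ (?d - 1))"
  have C: "C k \<subseteq> {..<b ^ k}" "0 \<in> C k" "card (C k) = a ^ k" for k
    using ab card_digit_set_eq[OF ab(1,2)] by (auto simp: C_def digit_set_def)
  have dim: "fractal_dim \<P> \<le> ereal \<delta>'"
  proof (rule fractal_dim_crossbars_le[OF ab(3) _ powr])
    show "\<exists>C N. C \<subseteq> digit_set a b \<and> P = crossbar C N" if "P \<in> \<P>" for P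
      using that by (auto simp: \<P>_def C_def)
  qed (use \<open>\<delta>' \<ge> 1\<close> in simp)
  have "\<exists>P\<in>\<P>. card P \<ge> n\<^sub>0 \<and>
      (\<forall>(c :: real) (G :: (real ^ 'n) pair_pre_digraph) w.
        c \<ge> 1 \<and> spanner c P G w \<longrightarrow>
        real (treewidth G) \<ge>
          \<kappa> * (real (card P) powr (1 - 1 / \<delta>') / c ^ (CARD('n) - 1)))" for n\<^sub>0
  proof (intro bexI conjI allI impI)
    \<comment> \<open>Index \<open>n\<^sub>0\<close> is large enough, since one line already has
      \<open>b ^ n\<^sub>0 > n\<^sub>0\<close> points.\<close>
    let ?P = "crossbar (C n\<^sub>0) (b ^ n\<^sub>0) :: (real ^ 'n) set"
    let ?m = "real (a ^ n\<^sub>0) ^ (?d - 1)"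
    show "?P \<in> \<P>" by (simp add: \<P>_def)
    have "n\<^sub>0 < b ^ n\<^sub>0" using ab(3) by (intro power_gt_expt) simp
    also have "\<dots> \<le> card ?P" using ab(3) by (intro card_crossbar_ge[OF C(2)]) simp
    finally show "n\<^sub>0 \<le> card ?P" by simp
    fix c :: real and G :: "(real ^ 'n) pair_pre_digraph" and w
    assume G: "c \<ge> 1 \<and> spanner c ?P G w"
    have "C n\<^sub>0 \<noteq> {}" using C(2) by blast
    then have tw: "?m \<le> 2 * ?d * treewidth G * (5 * c) ^ (?d - 1)"
      using spanner_crossbar_treewidth[of c "C n\<^sub>0" "b ^ n\<^sub>0" G w] G C by simp
    \<comment> \<open>There are at most \<open>?d * ?N powr \<delta>'\<close> points. The exponent
      \<open>1 - 1 / \<delta>'\<close> turns the second factor into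
      \<open>?N powr (\<delta>' - 1)\<close>, which is \<open>?m\<close>, and does not increase the
      first.\<close>
    have size: "real (card ?P) powr (1 - 1 / \<delta>') \<le> ?d * ?m"
    proof -
      let ?N = "real (b ^ n\<^sub>0)"
      have "finite (C n\<^sub>0)" by (simp add: C_def)
      from card_crossbar_le[OF this, of "b ^ n\<^sub>0", where 'n = 'n]
      have "real (card ?P) \<le> real (?d * b ^ n\<^sub>0 * (a ^ n\<^sub>0) ^ (?d - 1))"
        unfolding C(3) by (rule of_nat_mono)
      also have "\<dots> = ?d * (?N * ?m)" by simp
      also have Nm: "?N * ?m = ?N powr \<delta>'"
      proof -
        have "?N * ?m = real (b * a ^ (?d - 1)) ^ n\<^sub>0"
          by (simp add: power_mult_distrib mult.commute flip: power_mult)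
        also have "\<dots> = (real b ^ n\<^sub>0) powr \<delta>'"
          unfolding powr[symmetric] using ab(3) by (intro powr_power_commute) simp
        also have "\<dots> = ?N powr \<delta>'" by simp
        finally show ?thesis .
      qed
      finally have "real (card ?P) powr (1 - 1 / \<delta>') \<le> (?d * ?N powr \<delta>') powr (1 - 1 / \<delta>')"
        using \<open>\<delta>' \<ge> 1\<close> by (intro powr_mono2) auto
      also have "\<dots> = ?d powr (1 - 1 / \<delta>') * ?N powr (\<delta>' - 1)"
        using \<open>\<delta>' \<ge> 1\<close> by (simp add: powr_mult powr_powr algebra_simps)
      also have "?N powr (\<delta>' - 1) = ?m"
        using Nm ab(3) by (simp add: powr_diff field_simps)
      also have "?d powr (1 - 1 / \<delta>') * ?m \<le> ?d powr 1 * ?m"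
        using \<open>\<delta>' \<ge> 1\<close> assms(1) by (intro mult_right_mono powr_mono) auto
      finally show ?thesis by simp
    qed
    let ?c = "c ^ (?d - 1)"
    have "?c > 0" using G by simp
    have "real (card ?P) powr (1 - 1 / \<delta>') \<le> ?d * (2 * ?d * treewidth G * (5 * c) ^ (?d - 1))"
      using size mult_left_mono[OF tw, of "real ?d"] by linarith
    also have "\<dots> = treewidth G * ?c / \<kappa>"
      by (simp add: \<kappa>_def power_mult_distrib power2_eq_square)
    finally show "\<kappa> * (real (card ?P) powr (1 - 1 / \<delta>') / ?c) \<le> treewidth G"
      using \<open>?c > 0\<close> by (simp add: \<kappa>_def field_simps)
  qed
  moreover have "\<forall>P\<in>\<P>. finite P" using finite_crossbar by (auto simp: \<P>_def)
  moreover have "\<kappa> > 0" by (simp add: \<kappa>_def)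
  ultimately show ?thesis using close dim by blast
qed

end
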